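(* Let $M$ be a perfect matching with an even number of edges, whose vertex set is in general position (no three collinear), and with no vertical segment. Let $L$ be the set of left endpoints and $R$ the set of right endpoints of the segments of $M$. Then there is a perfect matching $M_L$ of $L$ and a perfect matching $M_R$ of $R$ such that no edge of $M$ crosses an edge of $M_L\cup M_R$ (although an edge of $M_L$ may cross an edge of $M_R$).
   Context: A geometric graph has straight-segment edges joining points of its vertex set; two edges cross if they intersect at a point other than a common endpoint; the graph is non-crossing if no two edges cross. A perfect matching of a point set is a non-crossing geometric graph on that set in which every vertex has degree exactly one. *)

theory Defs
  imports "HOL-Analysis.Analysis"
begin

type_synonym point = "real \<times> real"

text \<open>An edge is identified with the set of its two endpoints; the straight segment
  it represents is the convex hull of that set.\<close>

definition geometric_graph :: "point set \<Rightarrow> point set set \<Rightarrow> bool" where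
  "geometric_graph V E \<longleftrightarrow>
     finite V \<and> (\<forall>e\<in>E. \<exists>p\<in>V. \<exists>q\<in>V. p \<noteq> q \<and> e = {p, q})"

definition crosses :: "point set \<Rightarrow> point set \<Rightarrow> bool" where
  "crosses e f \<longleftrightarrow>
     e \<noteq> f \<and> (\<exists>x. x \<in> convex hull e \<and> x \<in> convex hull f \<and> x \<notin> e \<inter> f)"

definition non_crossing :: "point set set \<Rightarrow> bool" where
  "non_crossing E \<longleftrightarrow> (\<forall>e\<in>E. \<forall>f\<in>E. \<not> crosses e f)"

definition vertex_degree :: "point set set \<Rightarrow> point \<Rightarrow> nat" where
  "vertex_degree E v = card {e \<in> E. v \<in> e}"

definition perfect_matching :: "point set \<Rightarrow> point set set \<Rightarrow> bool" where
  "perfect_matching V E \<longleftrightarrow>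
     geometric_graph V E \<and> non_crossing E \<and> (\<forall>v\<in>V. vertex_degree E v = 1)"

definition general_position :: "point set \<Rightarrow> bool" where
  "general_position V \<longleftrightarrow>
     (\<forall>a\<in>V. \<forall>b\<in>V. \<forall>c\<in>V. a \<noteq> b \<and> a \<noteq> c \<and> b \<noteq> c \<longrightarrow> \<not> collinear {a, b, c})"

definition vertical :: "point set \<Rightarrow> bool" where
  "vertical e \<longleftrightarrow> (\<exists>p q. p \<noteq> q \<and> e = {p, q} \<and> fst p = fst q)"

definition left_endpoints :: "point set set \<Rightarrow> point set" where
  "left_endpoints E = {p. \<exists>q. {p, q} \<in> E \<and> fst p < fst q}"

definition right_endpoints :: "point set set \<Rightarrow> point set" where
  "right_endpoints E = {q. \<exists>p. {p, q} \<in> E \<and> fst p < fst q}"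

end

theory Submission
  imports Defs
begin

text \<open>
  By symmetry it suffices to match the left endpoints \<open>L\<close>. Extend the segments one after another to the
  right until they hit another (extended) segment or leave a large half plane. Now the left
  endpoints are the only places where a taut string avoiding the segments can bend: if
  \<open>a c\<close> and \<open>c b\<close> avoid the extended segments and the segment at \<open>c\<close> does not enter the triangle
  \<open>a b c\<close>, then \<open>a\<close> and \<open>b\<close> are joined by a chain of visibility edges between points of \<open>L\<close> that
  is shorter than \<open>|a c| + |c b|\<close>.

  Among all sets of visibility edges in which every point of \<open>L\<close> has odd degree, take one of
  minimal total length. If a point \<open>c\<close> had three neighbours, two of them would lie on the same
  side of the segment at \<open>c\<close>, and replacing their edges to \<open>c\<close> by the shortcut (modulo 2) would
  reduce the length; two crossing edges could be shortened in the same way at their crossing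
  point. So the minimiser is a non-crossing perfect matching. Such edge sets exist because they do when no
  segment is present, and inserting the segments by decreasing right end, each visibility edge cut by the new
  segment can be rerouted around its left endpoint by two shortcuts.
\<close>

section \<open>Determinants and affine coordinates in the plane\<close>

definition det2 :: "point \<Rightarrow> point \<Rightarrow> real" where
  "det2 u v = fst u * snd v - snd u * fst v"

text \<open>Makes collinearity the vanishing of a bilinear form. Non-collinearity then passes to a
  derived triangle through an explicit nonzero factor, and the sign of the form tells the sides of a
  line apart.\<close>

lemma collinear_iff_det2: "collinear {a, b, c :: point} \<longleftrightarrow> det2 (b - a) (c - a) = 0"
proof -
  have *: "collinear {a,b,c} \<longleftrightarrow> collinear {0, b - a, c - a}"
    using collinear_3[of b a c] by (metis NO_MATCH_def insert_commute)
  have "(b - a = 0 \<or> c - a = 0 \<or> (\<exists>k. c - a = k *\<^sub>R (b - a))) \<longleftrightarrow> det2 (b - a) (c - a) = 0" (is "?l = ?r")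
  proof
    show "?l \<Longrightarrow> ?r" by (elim disjE exE; simp only:; simp add: det2_def)
    assume d: ?r
    show ?l
    proof (cases "b - a = 0")
      case False
      define u v where "u = b - a" and "v = c - a"
      have d': "fst u * snd v = snd u * fst v" using d by (simp add: det2_def u_def v_def)
      have "u \<noteq> 0" using False u_def by simp
      then have "fst u \<noteq> 0 \<or> snd u \<noteq> 0" by (simp add: prod_eq_iff)
      then have "\<exists>k. v = k *\<^sub>R u"
      proof
        assume "fst u \<noteq> 0" then show ?thesis using d'
          by (intro exI[of _ "fst v / fst u"]) (auto simp: prod_eq_iff field_simps)
      next
        assume "snd u \<noteq> 0" then show ?thesis using d'
          by (intro exI[of _ "snd v / snd u"]) (auto simp: prod_eq_iff field_simps)
      qed
      then show ?thesis by (simp add: u_def v_def)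
    qed simp
  qed
  then show ?thesis using * collinear_lemma by metis
qed

text \<open>Cramer's rule: both coefficients are quotients of determinants by
  \<open>D\<close>.\<close>

lemma point_coordinates:
  assumes "\<not> collinear {a, b, c :: point}"
  obtains \<alpha> \<beta> where "x = a + \<alpha> *\<^sub>R (b - a) + \<beta> *\<^sub>R (c - a)"
proof -
  define D where "D = det2 (b - a) (c - a)"
  have D: "D \<noteq> 0" using assms by (simp add: collinear_iff_det2 D_def)
  have "x = a + (det2 (x - a) (c - a) / D) *\<^sub>R (b - a) + (det2 (b - a) (x - a) / D) *\<^sub>R (c - a)"
    using D unfolding prod_eq_iff 
    by (auto simp: field_simps) (auto simp: D_def det2_def algebra_simps)
  then show ?thesis using that by blast
qed

lemma coordinates_unique:
  assumes "\<not> collinear {a, b, c :: point}"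
    and "\<alpha> *\<^sub>R (b - a) + \<beta> *\<^sub>R (c - a) = \<alpha>' *\<^sub>R (b - a) + \<beta>' *\<^sub>R (c - a)"
  shows "\<alpha> = \<alpha>'" "\<beta> = \<beta>'"
proof -
  define u v where "u = b - a" and "v = c - a"
  have D: "det2 u v \<noteq> 0" using assms by (simp add: collinear_iff_det2 u_def v_def)
  have e: "(\<alpha> - \<alpha>') *\<^sub>R u + (\<beta> - \<beta>') *\<^sub>R v = 0" using assms(2) by (simp add: u_def v_def algebra_simps)
  have "det2 ((\<alpha> - \<alpha>') *\<^sub>R u + (\<beta> - \<beta>') *\<^sub>R v) v = (\<alpha> - \<alpha>') * det2 u v"
    "det2 u ((\<alpha> - \<alpha>') *\<^sub>R u + (\<beta> - \<beta>') *\<^sub>R v) = (\<beta> - \<beta>') * det2 u v"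
    by (simp_all add: det2_def algebra_simps)
  then show "\<alpha> = \<alpha>'" "\<beta> = \<beta>'" using D unfolding e by (simp_all add: det2_def)
qed

lemma dist_triangle_strict:
  assumes "\<not> collinear {a, b, c :: point}"
  shows "dist a b < dist a c + dist c b"
proof -
  have "\<not> between (a, b) c"
    using assms between_imp_collinear[of a b c] by (metis insert_commute)
  then show ?thesis using dist_triangle[of a b c] by (simp add: between)
qed

text \<open>A short enough step from a point inside the side \<open>a d\<close> towards the side of
  \<open>c\<close> stays in the triangle. It serves to exclude barriers that pass through
  \<open>a d\<close> towards \<open>c\<close>.\<close>

lemma enters_triangle:
  fixes a c d y q :: point
  assumes nc: "\<not> collinear {a, d, c}" and y: "y \<in> open_segment a d"
    and q: "q = a + \<alpha> *\<^sub>R (d - a) + \<beta> *\<^sub>R (c - a)" and "\<beta> > 0"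
  obtains m where "m \<in> closed_segment y q" "m \<in> convex hull {a, d, c}" "m \<notin> closed_segment a d"
proof -
  obtain s where s: "0 < s" "s < 1" "y = a + s *\<^sub>R (d - a)"
    using y by (auto simp: in_segment algebra_simps)
  \<comment> \<open>\<open>M\<close> bounds how fast the constraints \<open>u \<ge> 0\<close> and
    \<open>u + v \<le> 1\<close> are used up along the way to \<open>q\<close>, and \<open>k\<close>
    is the slack that both have at \<open>y\<close>. A step of relative size \<open>k / M\<close>
    therefore respects them, while \<open>\<beta> > 0\<close> gives \<open>v > 0\<close>.\<close>
  define M where "M = 1 + \<bar>\<alpha> - s\<bar> + \<beta>"
  have M: "M > 0" "\<bar>\<alpha> - s\<bar> \<le> M" "(\<alpha> - s) + \<beta> \<le> M" "M \<ge> 1" using \<open>\<beta> > 0\<close> by (auto simp: M_def)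
  define k where "k = min s (1 - s)"
  define \<epsilon> where "\<epsilon> = k / M"
  have k: "k > 0" "k \<le> s" "k \<le> 1 - s" using s by (auto simp: k_def)
  have \<epsilon>: "\<epsilon> > 0" "\<epsilon> \<le> 1" "\<epsilon> * M = k" using M k s by (auto simp: \<epsilon>_def field_simps)
  have e1: "\<epsilon> * (s - \<alpha>) \<le> k" using mult_left_mono[of "s - \<alpha>" M \<epsilon>] M \<epsilon> by (auto simp: abs_le_iff)
  have e2: "\<epsilon> * ((\<alpha> - s) + \<beta>) \<le> k" using mult_left_mono[of "(\<alpha> - s) + \<beta>" M \<epsilon>] M \<epsilon> by auto
  define m where "m = y + \<epsilon> *\<^sub>R (q - y)"
  define u v where "u = s + \<epsilon> * (\<alpha> - s)" and "v = \<epsilon> * \<beta>"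
  have m: "m = a + u *\<^sub>R (d - a) + v *\<^sub>R (c - a)"
    unfolding m_def q s(3) u_def v_def by (simp add: algebra_simps)
  have uv: "u \<ge> 0" "v > 0" "u + v \<le> 1"
    using e1 e2 k \<epsilon> \<open>\<beta> > 0\<close> by (auto simp: u_def v_def algebra_simps)
  have 1: "m \<in> closed_segment y q" unfolding m_def in_segment using \<epsilon>
    by (intro exI[of _ \<epsilon>]) (auto simp: algebra_simps)
  have 2: "m \<in> convex hull {a, d, c}" unfolding convex_hull_3_alt using m uv by fastforce
  have 3: "m \<notin> closed_segment a d"
  proof
    assume "m \<in> closed_segment a d"
    then obtain t where "m = a + t *\<^sub>R (d - a)" by (auto simp: in_segment algebra_simps)
    then have "u *\<^sub>R (d - a) + v *\<^sub>R (c - a) = t *\<^sub>R (d - a) + 0 *\<^sub>R (c - a)" using m by simp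
    from coordinates_unique(2)[OF nc this] uv show False by simp
  qed
  show ?thesis using that 1 2 3 by blast
qed

section \<open>Parity of degrees and total length of edge sets\<close>

definition odd_vertices :: "'a set set \<Rightarrow> 'a set" where
  "odd_vertices P = {v. odd (card {f \<in> P. v \<in> f})}"

lemma odd_card_sym_diff:
  assumes "finite A" "finite B"
  shows "odd (card (sym_diff A B)) \<longleftrightarrow> odd (card A) \<noteq> odd (card B)"
proof -
  have "card (sym_diff A B) = card (A - B) + card (B - A)"
    using assms by (intro card_Un_disjoint) auto
  moreover have "card A = card (A - B) + card (A \<inter> B)" "card B = card (B - A) + card (A \<inter> B)"
    using assms card_Diff_subset_Int[of A B] card_Diff_subset_Int[of B A]
      card_mono[of A "A \<inter> B"] card_mono[of B "A \<inter> B"] by (auto simp: Int_commute)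
  ultimately show ?thesis by presburger
qed

text \<open>Linearity over the field with two elements: symmetric difference is addition and
  \<open>odd_vertices\<close> is the boundary map. A finite \<open>P\<close> with
  \<open>odd_vertices P = T\<close> is a T-join, so T-joins can be added and exchanged
  freely.\<close>

lemma odd_vertices_sym_diff:
  assumes "finite P" "finite Q"
  shows "odd_vertices (sym_diff P Q) = sym_diff (odd_vertices P) (odd_vertices Q)"
proof -
  have "{f \<in> sym_diff P Q. v \<in> f} = sym_diff {f \<in> P. v \<in> f} {f \<in> Q. v \<in> f}" for v by auto
  then show ?thesis using assms by (auto simp: odd_vertices_def odd_card_sym_diff)
qed

lemma odd_vertices_singleton: "odd_vertices {f} = f"
proof -
  have "{g \<in> {f}. v \<in> g} = (if v \<in> f then {f} else {})" for v by auto
  then show ?thesis by (auto simp: odd_vertices_def)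
qed

lemma odd_vertices_empty: "odd_vertices {} = {}" by (simp add: odd_vertices_def)

text \<open>The double sum needs no choice of an order on the endpoints: each unordered pair is
  counted twice and the diagonal contributes zero.\<close>

definition edge_length :: "point set \<Rightarrow> real" where
  "edge_length f = (\<Sum>x\<in>f. \<Sum>y\<in>f. dist x y) / 2"

lemma edge_length_pair: "edge_length {a, b} = dist a b"
  by (cases "a = b") (auto simp: edge_length_def dist_commute)

lemma edge_length_nonneg: "edge_length f \<ge> 0"
  by (auto simp: edge_length_def intro!: sum_nonneg)

definition weight :: "point set set \<Rightarrow> real" where
  "weight P = (\<Sum>f\<in>P. edge_length f)"

text \<open>Edges that cancel modulo 2 only lower the total length.\<close>

lemma weight_sym_diff:
  assumes "finite P" "finite Q"
  shows "weight (sym_diff P Q) \<le> weight P + weight Q"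
proof -
  have "weight (sym_diff P Q) = weight (P - Q) + weight (Q - P)"
    unfolding weight_def using assms by (intro sum.union_disjoint) auto
  also have "\<dots> \<le> weight P + weight Q"
    unfolding weight_def using assms by (intro add_mono sum_mono2) (auto simp: edge_length_nonneg)
  finally show ?thesis .
qed

text \<open>Measured along \<open>q - p\<close>, the point \<open>u\<close> lies at offset
  \<open>- A\<close> and \<open>v\<close> at offset \<open>B\<close> from \<open>y\<close>, with
  \<open>A\<close> and \<open>B\<close> nonnegative. Thus a barrier meeting a segment on both sides
  of \<open>y\<close> has \<open>y\<close> on that segment.\<close>

lemma between_segment_points:
  fixes p q u v y :: point
  assumes "y \<in> closed_segment p q" "u \<in> closed_segment y p" "v \<in> closed_segment y q"
  shows "y \<in> closed_segment u v"
proof -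
  obtain t where t: "0 \<le> t" "t \<le> 1" "y = p + t *\<^sub>R (q - p)"
    using assms(1) by (auto simp: in_segment algebra_simps)
  obtain s where s: "0 \<le> s" "s \<le> 1" "u = y + s *\<^sub>R (p - y)"
    using assms(2) by (auto simp: in_segment algebra_simps)
  obtain r where r: "0 \<le> r" "r \<le> 1" "v = y + r *\<^sub>R (q - y)"
    using assms(3) by (auto simp: in_segment algebra_simps)
  define A B where "A = s * t" and "B = r * (1 - t)"
  have AB: "A \<ge> 0" "B \<ge> 0" using t s r by (auto simp: A_def B_def)
  have u: "u = y - A *\<^sub>R (q - p)" unfolding s(3) A_def by (subst (2) t(3)) (simp add: algebra_simps)
  have v: "v = y + B *\<^sub>R (q - p)" unfolding r(3) B_def by (subst (2) t(3)) (simp add: algebra_simps)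
  show ?thesis
  proof (cases "A + B = 0")
    case True
    then have "A = 0" using AB by linarith
    then show ?thesis using u by simp
  next
    case False
    define k where "k = A / (A + B)"
    have k: "0 \<le> k" "k \<le> 1" "k * (A + B) = A" using AB False by (auto simp: k_def divide_simps)
    have "(1 - k) *\<^sub>R u + k *\<^sub>R v = y + (k * (A + B) - A) *\<^sub>R (q - p)"
      unfolding u v by (simp add: algebra_simps)
    then have "y = (1 - k) *\<^sub>R u + k *\<^sub>R v" using k by simp
    then show ?thesis unfolding in_segment using k by blast
  qed
qed

lemma closed_segment_imp_collinear:
  "x \<in> closed_segment a b \<Longrightarrow> collinear {a, b, x :: point}"
  using between_imp_collinear[of a b x] by (simp add: between_mem_segment insert_commute)

lemma finite_has_max:
  fixes f :: "'a \<Rightarrow> real"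
  assumes "finite B" "B \<noteq> {}"
  obtains p where "p \<in> B" "\<And>q. q \<in> B \<Longrightarrow> f q \<le> f p"
  using assms Max_in[of "f ` B"] Max_ge[of "f ` B"] by (metis (no_types, lifting) finite_imageI image_iff image_is_empty)

section \<open>Barriers, visibility and taut strings\<close>

declare split_paired_Ex [simp del] split_paired_All [simp del]

text \<open>The barrier of \<open>p\<close> is the segment from \<open>p\<close> to \<open>e p\<close>; \<open>L\<close> is the vertex set, and only the
  barriers of the points of \<open>K\<close> obstruct visibility. The subfamily \<open>K\<close> must be closed under passing
  from a barrier to the one that stops it. Beyond the line \<open>n \<bullet> x = X\<close> nothing matters.\<close>

locale barriers =
  fixes n :: point and X :: real and L K :: "point set" and e :: "point \<Rightarrow> point"
  assumes finite_L: "finite L"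
    and K_sub: "K \<subseteq> L"
    and general: "\<lbrakk>a \<in> L; b \<in> L; c \<in> L; a \<noteq> b; a \<noteq> c; b \<noteq> c\<rbrakk> \<Longrightarrow> \<not> collinear {a, b, c}"
    and general_end: "\<lbrakk>p \<in> L; a \<in> L; a \<noteq> p\<rbrakk> \<Longrightarrow> \<not> collinear {p, e p, a}"
    and below: "p \<in> L \<Longrightarrow> n \<bullet> p < X"
    and end_right: "p \<in> L \<Longrightarrow> n \<bullet> p < n \<bullet> e p"
    and barriers_meet: "\<lbrakk>p \<in> L; q \<in> L; p \<noteq> q\<rbrakk> \<Longrightarrow>
          closed_segment p (e p) \<inter> closed_segment q (e q) \<subseteq> {e p, e q}"
    and ends: "p \<in> K \<Longrightarrow> n \<bullet> e p = X \<or> (\<exists>q\<in>K. e p \<in> closed_segment q (e q) \<and> e p \<noteq> e q)"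
begin

text \<open>The endpoints are exempt because the barriers of \<open>a\<close> and \<open>b\<close>,
  if present in \<open>K\<close>, start there.\<close>

definition visible :: "point \<Rightarrow> point \<Rightarrow> bool" where
  "visible a b \<longleftrightarrow> a \<in> L \<and> b \<in> L \<and> a \<noteq> b \<and>
     (\<forall>p\<in>K. closed_segment p (e p) \<inter> closed_segment a b \<subseteq> {a, b})"

definition visible_edges :: "point set set" where
  "visible_edges = {{a, b} | a b. visible a b}"

lemma vertex_on_segment: "\<lbrakk>a \<in> L; b \<in> L; w \<in> L; w \<in> closed_segment a b\<rbrakk> \<Longrightarrow> w = a \<or> w = b"
  using general[of a b w] closed_segment_imp_collinear[of w a b] by (cases "a = b") auto

lemma vertex_on_barrier: "\<lbrakk>p \<in> L; w \<in> L; w \<in> closed_segment p (e p)\<rbrakk> \<Longrightarrow> w = p"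
  using general_end[of p w] closed_segment_imp_collinear[of w p "e p"] by auto

lemma barrier_inner_less:
  assumes "p \<in> L" "x \<in> closed_segment p (e p)" "x \<noteq> e p"
  shows "n \<bullet> x < n \<bullet> e p"
proof -
  obtain t where t: "0 \<le> t" "t \<le> 1" "x = (1 - t) *\<^sub>R p + t *\<^sub>R e p"
    using assms(2) by (auto simp: in_segment)
  then have "t < 1" using assms(3) by (cases "t = 1") auto
  then have "(1 - t) * (n \<bullet> p) < (1 - t) * (n \<bullet> e p)" using end_right[OF assms(1)] by simp
  then show ?thesis unfolding t(3) by (simp add: inner_add_right algebra_simps)
qed

text \<open>Among the barriers entering the triangle take the one reaching furthest in direction \<open>n\<close>.
  It is not stopped inside, since the barrier stopping it would reach further. So it both
  enters and leaves the triangle, and both times through the edge \<open>a d\<close>.\<close>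

lemma barrier_avoids_triangle:
  assumes nc: "\<not> collinear {a, d, c}" and d: "d \<in> closed_segment c b"
    and below: "n \<bullet> a < X" "n \<bullet> c < X" "n \<bullet> d < X"
    and O1: "\<And>p. p \<in> K \<Longrightarrow> closed_segment p (e p) \<inter> (closed_segment a c \<union> closed_segment c b) \<subseteq> {a, b, c}"
    and O2: "\<And>p. p \<in> K \<Longrightarrow> c \<in> closed_segment p (e p) \<Longrightarrow> closed_segment p (e p) \<inter> convex hull {a, b, c} \<subseteq> {c}"
    and empty: "L \<inter> convex hull {a, d, c} \<subseteq> closed_segment a d \<union> {c}"
    and p: "p \<in> K"
  shows "closed_segment p (e p) \<inter> convex hull {a, d, c} \<subseteq> closed_segment a d \<union> {c}"
proof (rule ccontr)
  let ?Q = "convex hull {a, d, c}"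
  define B where "B = {p \<in> K. \<not> closed_segment p (e p) \<inter> ?Q \<subseteq> closed_segment a d \<union> {c}}"
  assume "\<not> ?thesis"
  then have "B \<noteq> {}" using p unfolding B_def by blast
  moreover have "finite B" unfolding B_def using finite_L K_sub finite_subset[of K L] by simp
  ultimately obtain p where pB: "p \<in> B" and mx: "\<And>q. q \<in> B \<Longrightarrow> n \<bullet> e q \<le> n \<bullet> e p"
    using finite_has_max[of B "\<lambda>p. n \<bullet> e p"] by blast
  have pK: "p \<in> K" "p \<in> L" using pB K_sub by (auto simp: B_def)
  obtain y where y: "y \<in> closed_segment p (e p)" "y \<in> ?Q" "y \<notin> closed_segment a d" "y \<noteq> c"
    using pB unfolding B_def by blast
  have front: "frontier ?Q = closed_segment a d \<union> closed_segment d c \<union> closed_segment c a"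
    by (rule frontier_of_triangle) simp
  have inter: "interior ?Q = ?Q - (closed_segment a d \<union> closed_segment d c \<union> closed_segment c a)"
    by (rule interior_of_triangle) simp
  have dcb: "closed_segment c d \<subseteq> closed_segment c b"
    using d by (simp add: closed_segment_subset)
  have Qsub: "?Q \<subseteq> convex hull {a, b, c}"
  proof (rule hull_minimal)
    have "d \<in> convex hull {a, b, c}" using d
      by (meson closed_segment_subset_convex_hull hull_inc insertI1 insertI2 subsetD)
    then show "{a, d, c} \<subseteq> convex hull {a, b, c}" by (auto simp: hull_inc)
  qed simp
  \<comment> \<open>The sides \<open>a c\<close> and \<open>c d\<close> offer no other way in:
    \<open>O1\<close> leaves only the three corners, and \<open>b\<close> can count only when it
    equals \<open>d\<close>.\<close>
  have sides: "x = c \<or> x \<in> closed_segment a d"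
    if "q \<in> K" "x \<in> closed_segment q (e q)" "x \<in> closed_segment a c \<union> closed_segment c d" for q x
  proof -
    have "x \<in> {a, b, c}" using O1[OF that(1)] that dcb by blast
    moreover have "x \<in> closed_segment a d" if "x = b"
    proof (cases "b \<in> closed_segment c d")
      case True
      then have "b = d" using d between_antisym[of d c b] by (simp add: between_mem_segment closed_segment_commute)
      then show ?thesis using that by simp
    next
      case False
      then have "b \<in> closed_segment a c" using \<open>x \<in> closed_segment a c \<union> closed_segment c d\<close> that by simp
      then have "closed_segment c b \<subseteq> closed_segment a c" by (simp add: closed_segment_subset)
      then have "d \<in> closed_segment a c" using d by blast
      then show ?thesis using nc closed_segment_imp_collinear[of d a c] by (simp add: insert_commute)
    qed
    ultimately show ?thesis by auto
  qed
  have y_int: "y \<in> interior ?Q"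
    unfolding inter using sides[OF pK(1) y(1)] y by (auto simp: closed_segment_commute)
  have Q_below: "n \<bullet> x < X" if "x \<in> ?Q" for x
  proof -
    have "?Q \<subseteq> {x. n \<bullet> x < X}" using below by (intro hull_minimal) (auto simp: convex_halfspace_lt)
    then show ?thesis using that by blast
  qed
  have p_int: "p \<notin> interior ?Q"
  proof
    assume "p \<in> interior ?Q"
    then have "p \<in> ?Q" "p \<notin> closed_segment a d" "p \<noteq> c" unfolding inter by auto
    then show False using empty pK by blast
  qed
  \<comment> \<open>A barrier ending inside would be stopped there by another one that also enters
    the triangle but reaches further, against the choice of \<open>p\<close>.\<close>
  have e_int: "e p \<notin> interior ?Q"
  proof
    assume "e p \<in> interior ?Q"
    then have i: "e p \<in> ?Q" "e p \<notin> closed_segment a d" "e p \<noteq> c" unfolding inter by auto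
    then obtain q where q: "q \<in> K" "e p \<in> closed_segment q (e q)" "e p \<noteq> e q"
      using ends[OF pK(1)] Q_below by fastforce
    then have "q \<in> B" using i unfolding B_def by blast
    then show False using mx[of q] barrier_inner_less[of q "e p"] q K_sub by auto
  qed
  have exit: "\<exists>u. u \<in> closed_segment y x \<and> u \<in> closed_segment a d"
    if "x \<notin> interior ?Q" "x \<in> closed_segment p (e p)" for x
  proof -
    have "\<exists>u. u \<in> closed_segment y x \<and> u \<in> frontier ?Q"
    proof (cases "x \<in> ?Q")
      case True
      then have "x \<in> frontier ?Q" using that(1) unfolding front inter by auto
      then show ?thesis by auto
    next
      case False
      then have "closed_segment y x \<inter> frontier ?Q \<noteq> {}"
        using y(2) by (intro connected_Int_frontier) auto
      then show ?thesis by auto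
    qed
    then obtain u where u: "u \<in> closed_segment y x" "u \<in> frontier ?Q" by blast
    have uT: "u \<in> closed_segment p (e p)"
      using u(1) y(1) that(2) closed_segment_subset[of y "closed_segment p (e p)" x] by auto
    \<comment> \<open>If the barrier reached \<open>c\<close>, then \<open>O2\<close> would allow it
      no other point of the triangle, yet it contains \<open>y\<close>.\<close>
    have "u \<noteq> c"
      using O2[OF pK(1)] y uT Qsub by blast
    then have "u \<in> closed_segment a d"
      using sides[OF pK(1) uT] u(2) unfolding front by (auto simp: closed_segment_commute)
    then show ?thesis using u by blast
  qed
  obtain u where u: "u \<in> closed_segment y p" "u \<in> closed_segment a d" using exit[OF p_int] by auto
  obtain v where v: "v \<in> closed_segment y (e p)" "v \<in> closed_segment a d" using exit[OF e_int] by auto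
  have "y \<in> closed_segment u v" by (rule between_segment_points[OF y(1) u(1) v(1)])
  then have "y \<in> closed_segment a d"
    using u v closed_segment_subset[of u "closed_segment a d" v] by auto
  then show False using y by simp
qed

text \<open>A barrier running through an inner point of \<open>a d\<close> cannot continue towards
  \<open>c\<close>, because \<open>barrier_avoids_triangle\<close> keeps it out of the triangle.
  Hence it runs along the line \<open>a d\<close>, and that line contains the two vertices
  \<open>a\<close> and \<open>z\<close>, against general position.\<close>

lemma barrier_avoids_edge:
  assumes nc: "\<not> collinear {a, d, c}" and d: "d \<in> closed_segment c b"
    and below: "n \<bullet> a < X" "n \<bullet> c < X" "n \<bullet> d < X"
    and O1: "\<And>p. p \<in> K \<Longrightarrow> closed_segment p (e p) \<inter> (closed_segment a c \<union> closed_segment c b) \<subseteq> {a, b, c}"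
    and O2: "\<And>p. p \<in> K \<Longrightarrow> c \<in> closed_segment p (e p) \<Longrightarrow> closed_segment p (e p) \<inter> convex hull {a, b, c} \<subseteq> {c}"
    and az: "a \<in> L" "z \<in> L" "z \<noteq> a" "z \<in> closed_segment a d"
    and empty: "L \<inter> convex hull {a, d, c} \<subseteq> {a, z, c}"
    and p: "p \<in> K"
  shows "closed_segment p (e p) \<inter> closed_segment a d \<subseteq> {a, z, d}"
proof (rule ccontr)
  assume "\<not> ?thesis"
  then obtain y where y: "y \<in> closed_segment p (e p)" "y \<in> closed_segment a d" "y \<notin> {a, z, d}" by blast
  have adQ: "closed_segment a d \<subseteq> convex hull {a, d, c}"
    by (simp add: closed_segment_subset_convex_hull hull_inc)
  have cad: "c \<notin> closed_segment a d" using nc closed_segment_imp_collinear by blast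
  have Qsub: "convex hull {a, d, c} \<subseteq> convex hull {a, b, c}"
  proof (rule hull_minimal)
    have "d \<in> convex hull {a, b, c}" using d
      by (meson closed_segment_subset_convex_hull hull_inc insertI1 insertI2 subsetD)
    then show "{a, d, c} \<subseteq> convex hull {a, b, c}" by (auto simp: hull_inc)
  qed simp
  \<comment> \<open>If the barrier of \<open>p\<close> ends at \<open>y\<close>, the barrier
    stopping it takes its place, so that \<open>y\<close> is not an end of the barrier
    considered.\<close>
  have "\<exists>q\<in>K. y \<in> closed_segment q (e q) \<and> y \<noteq> e q"
  proof (cases "y = e p")
    case True
    have "closed_segment a d \<subseteq> {x. n \<bullet> x < X}"
      using below by (intro closed_segment_subset) (auto simp: convex_halfspace_lt)
    then have "n \<bullet> e p < X" using y True by blast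
    then show ?thesis using ends[OF p] True by auto
  qed (use p y in auto)
  then obtain q where q: "q \<in> K" "y \<in> closed_segment q (e q)" "y \<noteq> e q" by blast
  have "q \<in> L" using q K_sub by blast
  have "y \<noteq> q" using y(2,3) cad adQ empty \<open>q \<in> L\<close> by blast
  have avoid: "closed_segment q (e q) \<inter> convex hull {a, d, c} \<subseteq> closed_segment a d \<union> {c}"
    using empty az(4) by (intro barrier_avoids_triangle[OF nc d below O1 O2 _ q(1)]) auto
  have c_not: "c \<notin> closed_segment q (e q)"
    using O2[OF q(1)] q(2) y(2) adQ Qsub cad by blast
  have yo: "y \<in> open_segment a d" using y by (auto simp: open_segment_def)
  have nonpos: "\<beta> \<le> 0" if x: "x = a + \<alpha> *\<^sub>R (d - a) + \<beta> *\<^sub>R (c - a)" "x \<in> closed_segment q (e q)" for x \<alpha> \<beta>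
  proof (rule ccontr)
    assume "\<not> \<beta> \<le> 0"
    then obtain m where m: "m \<in> closed_segment y x" "m \<in> convex hull {a, d, c}" "m \<notin> closed_segment a d"
      using enters_triangle[OF nc yo x(1)] by auto
    have "m \<in> closed_segment q (e q)"
      using m(1) q(2) x(2) closed_segment_subset[of y "closed_segment q (e q)" x] by auto
    then show False using avoid m c_not by blast
  qed
  obtain \<alpha>1 \<beta>1 where c1: "q = a + \<alpha>1 *\<^sub>R (d - a) + \<beta>1 *\<^sub>R (c - a)" using point_coordinates[OF nc] by blast
  obtain \<alpha>2 \<beta>2 where c2: "e q = a + \<alpha>2 *\<^sub>R (d - a) + \<beta>2 *\<^sub>R (c - a)" using point_coordinates[OF nc] by blast
  obtain t where t: "0 < t" "t < 1" "y = (1 - t) *\<^sub>R q + t *\<^sub>R e q"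
    using q \<open>y \<noteq> q\<close> by (auto simp: in_segment open_segment_def) (metis add.right_neutral diff_zero diff_self less_eq_real_def scale_one scale_zero_left add_0)
  obtain s where s: "y = a + s *\<^sub>R (d - a)" using y(2) by (auto simp: in_segment algebra_simps)
  have "((1 - t) * \<alpha>1 + t * \<alpha>2) *\<^sub>R (d - a) + ((1 - t) * \<beta>1 + t * \<beta>2) *\<^sub>R (c - a) = y - a"
    unfolding t(3) c2 by (subst c1) (simp add: algebra_simps)
  also have "\<dots> = s *\<^sub>R (d - a) + 0 *\<^sub>R (c - a)" using s by simp
  finally have b0: "(1 - t) * \<beta>1 + t * \<beta>2 = 0" using coordinates_unique(2)[OF nc] by blast
  \<comment> \<open>Both ends lie on the side of the line \<open>a d\<close> away from
    \<open>c\<close>, or on the line. As \<open>y\<close> is strictly between them and on the line,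
    both ends are on it.\<close>
  have "\<beta>1 \<le> 0" "\<beta>2 \<le> 0" using nonpos c1 c2 by auto
  then have "(1 - t) * \<beta>1 \<le> 0" "t * \<beta>2 \<le> 0" using t by (auto simp: mult_le_0_iff)
  then have "\<beta>1 = 0" "\<beta>2 = 0" using b0 t by (auto simp: add_nonpos_eq_0_iff)
  then have q_line: "q = a + \<alpha>1 *\<^sub>R (d - a)" "e q = a + \<alpha>2 *\<^sub>R (d - a)" using c1 c2 by auto
  have on_line: "w = q" if "w \<in> L" "w = a + \<gamma> *\<^sub>R (d - a)" for w \<gamma>
  proof (rule ccontr)
    assume "w \<noteq> q"
    then have "\<not> collinear {q, e q, w}" using general_end \<open>q \<in> L\<close> that by blast
    moreover have "e q - q = (\<alpha>2 - \<alpha>1) *\<^sub>R (d - a)"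
      by (subst q_line(2), subst q_line(1)) (simp add: algebra_simps)
    moreover have "w - q = (\<gamma> - \<alpha>1) *\<^sub>R (d - a)"
      by (subst that(2), subst q_line(1)) (simp add: algebra_simps)
    moreover have "det2 (s *\<^sub>R v) (t *\<^sub>R v) = 0" for s t v by (simp add: det2_def)
    ultimately show False by (simp add: collinear_iff_det2)
  qed
  have "a = q" using on_line[of a 0] az by simp
  moreover obtain r where "z = a + r *\<^sub>R (d - a)" using az(4) by (auto simp: in_segment algebra_simps)
  then have "z = q" using on_line az by blast
  ultimately show False using az by simp
qed

lemma visible_edges_pair: "visible a b \<Longrightarrow> {a, b} \<in> visible_edges" unfolding visible_edges_def by blast

text \<open>The taut string from \<open>a\<close> to \<open>b\<close> inside the triangle, up to cancellation modulo 2. Its first edge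
  \<open>a z\<close> is found by rotating the ray from \<open>a\<close> through \<open>c\<close> towards \<open>b\<close> until it hits a vertex \<open>z\<close>;
  if \<open>d\<close> is the point where that ray meets \<open>c b\<close>, the rest is the string for \<open>z d b\<close>. The corner
  \<open>c\<close> need not be a vertex.\<close>

lemma shortcut:
  assumes "a \<in> L" "b \<in> L" "\<not> collinear {a, b, c}" "n \<bullet> c < X"
    and "\<And>p. p \<in> K \<Longrightarrow> closed_segment p (e p) \<inter> (closed_segment a c \<union> closed_segment c b) \<subseteq> {a, b, c}"
    and "\<And>p. p \<in> K \<Longrightarrow> c \<in> closed_segment p (e p) \<Longrightarrow> closed_segment p (e p) \<inter> convex hull {a, b, c} \<subseteq> {c}"
    and "L \<inter> (closed_segment a c \<union> closed_segment c b) \<subseteq> {a, b, c}"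
  shows "\<exists>P\<subseteq>visible_edges. finite P \<and> odd_vertices P = {a, b} \<and> weight P < dist a c + dist c b \<and>
           (\<forall>f\<in>P. f \<subseteq> convex hull {a, b, c})"
  using assms
proof (induction "card (L \<inter> convex hull {a, b, c})" arbitrary: a c rule: less_induct)
  case less
  note O1 = less.prems(5) and O2 = less.prems(6) and O3 = less.prems(7)
  note nc = less.prems(3)
  let ?T = "convex hull {a, b, c}"
  have ne: "a \<noteq> b" "a \<noteq> c" "b \<noteq> c" using nc by (auto simp: collinear_iff_det2 det2_def)
  have nax: "n \<bullet> a < X" "n \<bullet> b < X" using less.prems below by auto
  define W where "W = L \<inter> ?T - {a, b, c}"
  show ?case
  proof (cases "W = {}")
    case True
    then have emp: "L \<inter> ?T \<subseteq> {a, b, c}" by (auto simp: W_def)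
    \<comment> \<open>Here \<open>b\<close> plays the roles of both \<open>z\<close> and
      \<open>d\<close>: the string is the single edge \<open>a b\<close>.\<close>
    have "closed_segment p (e p) \<inter> closed_segment a b \<subseteq> {a, b, b}" if "p \<in> K" for p
      by (rule barrier_avoids_edge[where c = c and b = b])
        (use nc nax less.prems emp ne that in auto)
    then have "visible a b" using less.prems ne by (auto simp: visible_def)
    moreover have "dist a b < dist a c + dist c b" by (rule dist_triangle_strict[OF nc])
    ultimately show ?thesis
      by (intro exI[of _ "{{a, b}}"])
        (auto simp: odd_vertices_singleton weight_def edge_length_pair visible_edges_pair hull_inc)
  next
    case False
    \<comment> \<open>Coordinates seen from \<open>a\<close>: \<open>t\<close> locates where the ray
      through \<open>w\<close> meets \<open>c b\<close>, and \<open>s\<close> is the position of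
      \<open>w\<close> on the way there. The inequalities are strict since \<open>O3\<close> keeps
      \<open>w\<close> off two sides and general position keeps it off \<open>a b\<close>.\<close>
    have "\<exists>s t. 0 < s \<and> s < 1 \<and> 0 < t \<and> t < 1 \<and> w = a + s *\<^sub>R (c + t *\<^sub>R (b - c) - a)" if w: "w \<in> W" for w
    proof -
      have wL: "w \<in> L" "w \<in> ?T" "w \<noteq> a" "w \<noteq> b" "w \<noteq> c" using w by (auto simp: W_def)
      obtain u v where uv: "0 \<le> u" "0 \<le> v" "u + v \<le> 1" "w = a + u *\<^sub>R (b - a) + v *\<^sub>R (c - a)"
        using wL(2) unfolding convex_hull_3_alt by blast
      have "u \<noteq> 0"
      proof
        assume "u = 0"
        then have "w \<in> closed_segment a c" unfolding in_segment using uv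
          by (intro exI[of _ v]) (auto simp: algebra_simps)
        then show False using O3 wL by blast
      qed
      moreover have "v \<noteq> 0"
      proof
        assume "v = 0"
        then have "w \<in> closed_segment a b" unfolding in_segment using uv
          by (intro exI[of _ u]) (auto simp: algebra_simps)
        then show False using vertex_on_segment[of a b w] less.prems wL by blast
      qed
      moreover have "u + v \<noteq> 1"
      proof
        assume "u + v = 1"
        then have v: "v = 1 - u" by simp
        have "w = (1 - u) *\<^sub>R c + u *\<^sub>R b" unfolding uv(4) v by (simp add: algebra_simps)
        then have "w \<in> closed_segment c b" unfolding in_segment using uv by auto
        then show False using O3 wL by blast
      qed
      ultimately have "0 < u" "0 < v" "u + v < 1" using uv by auto
      moreover from this have "(u + v) * (u / (u + v)) = u" by simp
      then have "a + (u + v) *\<^sub>R (c + (u / (u + v)) *\<^sub>R (b - c) - a) = w"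
        unfolding uv(4) scaleR_add_right scaleR_diff_right scaleR_scaleR
        by (simp add: algebra_simps)
      ultimately show ?thesis
        by (intro exI[of _ "u + v"] exI[of _ "u / (u + v)"]) auto
    qed
    then obtain s t where st: "\<And>w. w \<in> W \<Longrightarrow> 0 < s w \<and> s w < 1 \<and> 0 < t w \<and> t w < (1::real) \<and>
        w = a + s w *\<^sub>R (c + t w *\<^sub>R (b - c) - a)" by metis
    have "finite W" using finite_L by (auto simp: W_def)
    \<comment> \<open>The smallest \<open>t\<close> belongs to the ray met first when rotating from
      \<open>a c\<close> towards \<open>a b\<close>.\<close>
    then obtain z where zW: "z \<in> W" and mn: "\<And>w. w \<in> W \<Longrightarrow> - t w \<le> - t z"
      using finite_has_max[of W "\<lambda>w. - t w"] False by blast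
    define d where "d = c + t z *\<^sub>R (b - c)"
    have z: "z \<in> L" "z \<in> ?T" "z \<noteq> a" "z \<noteq> b" "z \<noteq> c" using zW by (auto simp: W_def)
    have z_eq: "z = a + s z *\<^sub>R (d - a)" and tz: "0 < t z" "t z < 1" and sz: "0 < s z" "s z < 1"
      using st[OF zW] by (auto simp: d_def)
    have d_cb: "d \<in> closed_segment c b" unfolding in_segment d_def using tz
      by (intro exI[of _ "t z"]) (auto simp: algebra_simps)
    have z_ad: "z \<in> closed_segment a d" unfolding in_segment using sz
      by (intro exI[of _ "s z"]) (subst z_eq, auto simp: algebra_simps)
    have dca: "d - a = t z *\<^sub>R (b - a) + (1 - t z) *\<^sub>R (c - a)" by (simp add: d_def algebra_simps)
    define D where "D = det2 (b - a) (c - a)"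
    have D: "D \<noteq> 0" using nc by (simp add: D_def collinear_iff_det2)
    have "det2 (d - a) (c - a) = t z * D"
      unfolding dca D_def by (simp add: det2_def algebra_simps)
    then have nc_adc: "\<not> collinear {a, d, c}" using tz D by (simp add: collinear_iff_det2)
    have "b - z = (1 - s z * t z) *\<^sub>R (b - a) - (s z * (1 - t z)) *\<^sub>R (c - a)"
      "d - z = (t z - s z * t z) *\<^sub>R (b - a) + ((1 - s z) * (1 - t z)) *\<^sub>R (c - a)"
      by (subst z_eq, simp add: d_def algebra_simps)+
    moreover have "det2 (k1 *\<^sub>R u - k2 *\<^sub>R v) (k3 *\<^sub>R u + k4 *\<^sub>R v) = (k1 * k4 + k2 * k3) * det2 u v" for k1 k2 k3 k4 u v
      by (simp add: det2_def algebra_simps)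
    ultimately have "det2 (b - z) (d - z) =
       ((1 - s z * t z) * ((1 - s z) * (1 - t z)) + (s z * (1 - t z)) * (t z - s z * t z)) * D"
      by (simp only: D_def)
    also have "((1 - s z * t z) * ((1 - s z) * (1 - t z)) + (s z * (1 - t z)) * (t z - s z * t z)) = (1 - s z) * (1 - t z)"
      by (simp add: algebra_simps)
    finally have nc_zbd: "\<not> collinear {z, b, d}" using tz sz D by (simp add: collinear_iff_det2)
    have ne_d: "d \<noteq> a" "d \<noteq> c" "d \<noteq> b" "d \<noteq> z" using nc_adc nc_zbd by (auto simp: collinear_iff_det2 det2_def)
    have nd: "n \<bullet> d < X"
    proof -
      have "closed_segment c b \<subseteq> {x. n \<bullet> x < X}"
        using nax less.prems by (intro closed_segment_subset) (auto simp: convex_halfspace_lt)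
      then show ?thesis using d_cb by blast
    qed
    have dT: "d \<in> ?T" using d_cb
      by (meson closed_segment_subset_convex_hull hull_inc insertI1 insertI2 subsetD)
    have Qsub: "convex hull {a, d, c} \<subseteq> ?T"
      using dT by (intro hull_minimal) (auto simp: hull_inc)
    \<comment> \<open>A vertex of \<open>W\<close> in this triangle has
      \<open>t w \<le> t z\<close>, so by the choice of \<open>z\<close> it lies on the ray of
      \<open>z\<close>. General position then leaves \<open>z\<close> alone.\<close>
    have emp: "L \<inter> convex hull {a, d, c} \<subseteq> {a, z, c}"
    proof
      fix w assume w: "w \<in> L \<inter> convex hull {a, d, c}"
      then obtain u v where uv: "0 \<le> u" "0 \<le> v" "u + v \<le> 1" "w = a + u *\<^sub>R (d - a) + v *\<^sub>R (c - a)"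
        unfolding convex_hull_3_alt by blast
      have w_bc: "w - a = (u * t z) *\<^sub>R (b - a) + (u * (1 - t z) + v) *\<^sub>R (c - a)"
        unfolding uv(4) dca by (simp add: algebra_simps)
      have "w \<noteq> b"
      proof
        assume "w = b"
        then have "(u * t z) *\<^sub>R (b - a) + (u * (1 - t z) + v) *\<^sub>R (c - a) = 1 *\<^sub>R (b - a) + 0 *\<^sub>R (c - a)"
          using w_bc by simp
        from coordinates_unique(1)[OF nc this] have "u * t z = 1" .
        moreover have "u * t z \<le> 1 * t z" using uv tz by (intro mult_right_mono) auto
        ultimately show False using tz by simp
      qed
      show "w \<in> {a, z, c}"
      proof (cases "w \<in> W")
        case True
        note sw = st[OF True]
        have "w - a = s w *\<^sub>R (c + t w *\<^sub>R (b - c) - a)"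
          using sw by (metis add_diff_cancel_left')
        also have "\<dots> = (s w * t w) *\<^sub>R (b - a) + (s w * (1 - t w)) *\<^sub>R (c - a)"
          by (simp add: algebra_simps)
        finally have "w - a = (s w * t w) *\<^sub>R (b - a) + (s w * (1 - t w)) *\<^sub>R (c - a)" .
        with w_bc have eq: "(u * t z) *\<^sub>R (b - a) + (u * (1 - t z) + v) *\<^sub>R (c - a) =
          (s w * t w) *\<^sub>R (b - a) + (s w * (1 - t w)) *\<^sub>R (c - a)" by simp
        have 1: "u * t z = s w * t w" "u * (1 - t z) + v = s w * (1 - t w)"
          using coordinates_unique[OF nc eq] by auto
        then have 2: "u + v = s w" by (simp add: algebra_simps)
        have "s w * t w \<le> s w * t z" using 1 2 uv tz by (metis add_increasing2 mult_right_mono order_refl less_imp_le)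
        then have "t w \<le> t z" using sw by simp
        then have "t w = t z" using mn[OF True] by simp
        then have w_eq: "w = a + s w *\<^sub>R (d - a)" using sw by (simp add: d_def)
        have "det2 (z - a) (w - a) = 0"
          by (subst z_eq, subst w_eq) (simp add: det2_def)
        then have "collinear {a, z, w}" by (simp add: collinear_iff_det2)
        then show ?thesis using general[of a z w] less.prems z w True by (auto simp: W_def)
      next
        case False
        then show ?thesis using w Qsub \<open>w \<noteq> b\<close> by (auto simp: W_def)
      qed
    qed
    have ad: "closed_segment p (e p) \<inter> closed_segment a d \<subseteq> {a, z, d}" if "p \<in> K" for p
      using that less.prems z z_ad nd nax emp
      by (intro barrier_avoids_edge[OF nc_adc d_cb _ _ _ O1 O2]) auto
    \<comment> \<open>Since \<open>d\<close> is an inner point of \<open>c b\<close>, no barrier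
      contains it, and the corner condition of the smaller triangle \<open>z b d\<close> becomes
      vacuous.\<close>
    have d_free: "d \<notin> closed_segment p (e p)" if "p \<in> K" for p
      using O1[OF that] d_cb ne_d by blast
    have zd_ad: "closed_segment z d \<subseteq> closed_segment a d" "closed_segment a z \<subseteq> closed_segment a d"
      using z_ad by (auto simp: closed_segment_subset)
    have db_cb: "closed_segment d b \<subseteq> closed_segment c b"
      using d_cb by (simp add: closed_segment_subset)
    have a_zd: "a \<notin> closed_segment z d"
      using z_ad \<open>z \<noteq> a\<close> between_antisym[of z d a]
      by (auto simp: between_mem_segment closed_segment_commute)
    have c_db: "c \<notin> closed_segment d b"
      using d_cb ne_d between_antisym[of d b c]
      by (auto simp: between_mem_segment closed_segment_commute)
    have a_cb: "a \<notin> closed_segment c b"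
      using closed_segment_imp_collinear[of a c b] nc by (auto simp: insert_commute)
    have c_ad: "c \<notin> closed_segment a d"
      using closed_segment_imp_collinear[of c a d] nc_adc by auto
    have ad_Q: "closed_segment a d \<subseteq> convex hull {a, d, c}"
      by (simp add: closed_segment_subset_convex_hull hull_inc)
    have vaz: "visible a z"
      unfolding visible_def using ad d_free zd_ad z less.prems by fastforce
    have T'sub: "convex hull {z, b, d} \<subseteq> ?T"
      using dT z by (intro hull_minimal) (auto simp: hull_inc)
    \<comment> \<open>Losing the vertex \<open>a\<close> makes the number of vertices drop, which is
      the measure of the induction.\<close>
    have a_T': "a \<notin> convex hull {z, b, d}"
    proof
      assume "a \<in> convex hull {z, b, d}"
      then obtain u v where uv: "0 \<le> u" "0 \<le> v" "u + v \<le> 1" "a = z + u *\<^sub>R (b - z) + v *\<^sub>R (d - z)"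
        unfolding convex_hull_3_alt by blast
      have zb: "z - a = (s z * t z) *\<^sub>R (b - a) + (s z * (1 - t z)) *\<^sub>R (c - a)"
        by (subst z_eq) (simp add: dca algebra_simps)
      have "0 = (1 - u - v) *\<^sub>R (z - a) + u *\<^sub>R (b - a) + v *\<^sub>R (d - a)"
        using uv(4) by (simp add: algebra_simps)
      also have "\<dots> = ((1 - u - v) * (s z * t z) + u + v * t z) *\<^sub>R (b - a) + ((1 - u - v) * (s z * (1 - t z)) + v * (1 - t z)) *\<^sub>R (c - a)"
        unfolding zb dca by (simp add: algebra_simps)
      finally have "((1 - u - v) * (s z * t z) + u + v * t z) *\<^sub>R (b - a) + ((1 - u - v) * (s z * (1 - t z)) + v * (1 - t z)) *\<^sub>R (c - a) = 0 *\<^sub>R (b - a) + 0 *\<^sub>R (c - a)"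
        by simp
      from coordinates_unique[OF nc this]
      have 1: "(1 - u - v) * (s z * t z) + u + v * t z = 0" by simp
      have "(1 - u - v) * (s z * t z) \<ge> 0" "v * t z \<ge> 0" using uv sz tz by auto
      then have "u = 0" "v * t z = 0" "(1 - u - v) * (s z * t z) = 0" using 1 uv by linarith+
      then show False using sz tz by auto
    qed
    have "L \<inter> convex hull {z, b, d} \<subset> L \<inter> ?T"
      using T'sub a_T' less.prems(1) by (auto simp: hull_inc)
    then have card': "card (L \<inter> convex hull {z, b, d}) < card (L \<inter> ?T)"
      using finite_L by (intro psubset_card_mono) auto
    have O1': "closed_segment p (e p) \<inter> (closed_segment z d \<union> closed_segment d b) \<subseteq> {z, b, d}" if "p \<in> K" for p
      using ad[OF that] O1[OF that] zd_ad db_cb a_zd c_db a_cb by blast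
    have O3': "L \<inter> (closed_segment z d \<union> closed_segment d b) \<subseteq> {z, b, d}"
      using emp O3 zd_ad ad_Q db_cb a_zd c_ad c_db a_cb by blast
    have "\<exists>P\<subseteq>visible_edges. finite P \<and> odd_vertices P = {z, b} \<and> weight P < dist z d + dist d b \<and>
           (\<forall>f\<in>P. f \<subseteq> convex hull {z, b, d})"
      by (rule less.hyps[OF card' z(1) less.prems(2) nc_zbd nd O1' _ O3']) (use d_free in blast)+
    then obtain P where P: "P \<subseteq> visible_edges" "finite P" "odd_vertices P = {z, b}" "weight P < dist z d + dist d b"
      "\<And>f. f \<in> P \<Longrightarrow> f \<subseteq> convex hull {z, b, d}" by blast
    define P' where "P' = sym_diff {{a, z}} P"
    have "P' \<subseteq> visible_edges" "finite P'" using P visible_edges_pair[OF vaz] by (auto simp: P'_def)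
    moreover have "odd_vertices P' = {a, b}"
      unfolding P'_def using P z ne by (subst odd_vertices_sym_diff) (auto simp: odd_vertices_singleton)
    moreover have "weight P' < dist a c + dist c b"
    proof -
      have "weight P' \<le> weight {{a, z}} + weight P" unfolding P'_def using P by (intro weight_sym_diff) auto
      also have "\<dots> < dist a z + dist z d + dist d b" using P by (simp add: weight_def edge_length_pair)
      also have "dist a z + dist z d = dist a d"
        using z_ad by (metis between between_mem_segment)
      also have "dist a d \<le> dist a c + dist c d" by (rule dist_triangle)
      also have "dist a c + dist c d + dist d b = dist a c + dist c b"
        using d_cb by (metis between between_mem_segment add.assoc)
      finally show ?thesis by simp
    qed
    moreover have "\<forall>f\<in>P'. f \<subseteq> ?T"
      using P(5) T'sub z by (auto simp: P'_def hull_inc)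
    ultimately show ?thesis by blast
  qed
qed

end

section \<open>T-joins made of visibility edges\<close>

lemma segment_antisym:
  fixes a b x :: point
  assumes "x \<in> closed_segment a b" "x \<noteq> b"
  shows "b \<notin> closed_segment a x"
  using assms between_antisym[of x a b] by (auto simp: between_mem_segment closed_segment_commute)

text \<open>By linearity it suffices to replace single edges; their substitutes are added modulo
  2.\<close>

lemma join_transfer:
  assumes "\<And>f. f \<in> A \<Longrightarrow> \<exists>P\<subseteq>B. finite P \<and> odd_vertices P = f"
    and "finite F" "F \<subseteq> A"
  shows "\<exists>P\<subseteq>B. finite P \<and> odd_vertices P = odd_vertices F"
  using assms(2,3)
proof (induction F)
  case empty
  then show ?case by blast
next
  case (insert f F)
  then obtain P where P: "P \<subseteq> B" "finite P" "odd_vertices P = odd_vertices F" by blast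
  obtain Q where Q: "Q \<subseteq> B" "finite Q" "odd_vertices Q = f" using assms(1) insert by blast
  have "insert f F = sym_diff {f} F" using insert by auto
  then have "odd_vertices (insert f F) = sym_diff (odd_vertices {f}) (odd_vertices F)" using insert by (metis odd_vertices_sym_diff finite.intros)
  also have "\<dots> = odd_vertices (sym_diff Q P)" using P Q by (simp add: odd_vertices_sym_diff odd_vertices_singleton)
  finally show ?case using P Q by (intro exI[of _ "sym_diff Q P"]) auto
qed

text \<open>Split \<open>S\<close> into pairs arbitrarily and add the joins of the pairs modulo
  2.\<close>

lemma even_set_join:
  assumes "\<And>a b. a \<in> S \<Longrightarrow> b \<in> S \<Longrightarrow> a \<noteq> b \<Longrightarrow> \<exists>P\<subseteq>B. finite P \<and> odd_vertices P = {a, b}"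
    and "finite S" "even (card S)"
  shows "\<exists>P\<subseteq>B. finite P \<and> odd_vertices P = S"
  using assms
proof (induction "card S" arbitrary: S rule: less_induct)
  case less
  show ?case
  proof (cases "S = {}")
    case True
    then show ?thesis by (intro exI[of _ "{}"]) (auto simp: odd_vertices_empty)
  next
    case False
    then have "card S \<noteq> 0" "card S \<noteq> 1" using less.prems by auto
    then have "2 \<le> card S" by simp
    then obtain T where T: "T \<subseteq> S" "card T = 2" by (meson obtain_subset_with_card_n)
    then obtain a b where ab: "T = {a, b}" "a \<noteq> b" by (auto simp: card_2_iff)
    have "card (S - T) = card S - 2" using T less.prems by (metis card_Diff_subset finite_subset)
    then have "card (S - T) < card S" "even (card (S - T))" using \<open>2 \<le> card S\<close> less.prems by auto
    then obtain P where P: "P \<subseteq> B" "finite P" "odd_vertices P = S - T"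
      using less.hyps[of "S - T"] less.prems by auto
    obtain Q where Q: "Q \<subseteq> B" "finite Q" "odd_vertices Q = T" using less.prems(1)[of a b] T ab by auto
    have "odd_vertices (sym_diff P Q) = S" using P Q T by (subst odd_vertices_sym_diff) auto
    then show ?thesis using P Q by (intro exI[of _ "sym_diff P Q"]) auto
  qed
qed

context barriers
begin

lemma visible_commute: "visible a b \<longleftrightarrow> visible b a"
  by (auto simp: visible_def closed_segment_commute insert_commute)

lemma visible_edges_pair_iff: "{a, b} \<in> visible_edges \<longleftrightarrow> visible a b"
  using visible_commute unfolding visible_edges_def by (auto simp: doubleton_eq_iff)

lemma det2_barrier:
  assumes "x \<in> closed_segment p (e p)"
  shows "det2 (e p - p) (x - p) = 0"
  using closed_segment_imp_collinear[OF assms] by (simp add: collinear_iff_det2)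

lemma segment_below:
  assumes "a \<in> L" "b \<in> L" "x \<in> closed_segment a b"
  shows "n \<bullet> x < X"
proof -
  have "closed_segment a b \<subseteq> {x. n \<bullet> x < X}"
    using assms below by (intro closed_segment_subset) (auto simp: convex_halfspace_lt)
  then show ?thesis using assms by blast
qed

text \<open>A barrier that stops another one at an inner point reaches strictly further in direction
  \<open>n\<close>. So the one with the smallest end stops nothing, and the closure condition on
  \<open>K\<close> survives its removal.\<close>

lemma remove_barrier:
  assumes "p \<in> K" "\<And>q. q \<in> K \<Longrightarrow> n \<bullet> e p \<le> n \<bullet> e q"
  shows "barriers n X L (K - {p}) e"
proof (unfold_locales, goal_cases)
  case (8 q)
  then consider "n \<bullet> e q = X" | q' where "q' \<in> K" "e q \<in> closed_segment q' (e q')" "e q \<noteq> e q'"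
    using ends[of q] by blast
  then show ?case
  proof cases
    case 2
    have "q' \<noteq> p" using 2 assms(2)[of q] 8 barrier_inner_less[of q' "e q"] K_sub by force
    then show ?thesis using 2 by blast
  qed simp
qed (use finite_L K_sub general general_end below end_right barriers_meet in blast)+

text \<open>As \<open>p\<close> minimises \<open>n \<bullet> e p\<close>, no other barrier stops at the barrier of \<open>p\<close>. Hence the
  part of the latter from \<open>p\<close> to \<open>y\<close> is clear and serves as a side of the triangle \<open>a y p\<close>.\<close>

lemma half_repair:
  assumes p: "p \<in> K" "\<And>q. q \<in> K \<Longrightarrow> n \<bullet> e p \<le> n \<bullet> e q"
    and ab: "barriers.visible L (K - {p}) e a b"
    and y: "y \<in> closed_segment p (e p)" "y \<in> closed_segment a b" "y \<noteq> a" "y \<noteq> b"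
  shows "\<exists>P\<subseteq>visible_edges. finite P \<and> odd_vertices P = {a, p} \<and> p \<noteq> a"
proof -
  interpret K': barriers n X L "K - {p}" e by (rule remove_barrier[OF p])
  have pL: "p \<in> L" using p K_sub by blast
  have abL: "a \<in> L" "b \<in> L" "a \<noteq> b" using ab by (auto simp: K'.visible_def)
  obtain s where s: "0 \<le> s" "s \<le> 1" "y = a + s *\<^sub>R (b - a)"
    using y(2) by (auto simp: in_segment algebra_simps)
  have s0: "s \<noteq> 0" "s \<noteq> 1" using s y by auto
  \<comment> \<open>Otherwise \<open>p\<close> and \<open>y\<close> would span the line of
    \<open>a b\<close>, and the barrier of \<open>p\<close> would be collinear with the vertex
    \<open>b\<close>.\<close>
  have pa: "p \<noteq> a"
  proof
    assume "p = a"
    have "det2 (e p - p) (y - p) = s * det2 (e p - p) (b - p)"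
      unfolding s(3) \<open>p = a\<close> by (simp add: det2_def algebra_simps)
    then have "collinear {p, e p, b}" using det2_barrier[OF y(1)] s0 by (simp add: collinear_iff_det2)
    then show False using general_end abL \<open>p = a\<close> pL by blast
  qed
  have pb: "p \<noteq> b"
  proof
    assume "p = b"
    have "det2 (e p - p) (y - p) = (1 - s) * det2 (e p - p) (a - p)"
      unfolding s(3) \<open>p = b\<close> by (simp add: det2_def algebra_simps)
    then have "collinear {p, e p, a}" using det2_barrier[OF y(1)] s0 by (simp add: collinear_iff_det2)
    then show False using general_end abL \<open>p = b\<close> pL by blast
  qed
  have "y \<noteq> p" using vertex_on_segment[OF abL(1,2) pL] y pa pb by blast
  have "det2 (p - a) (y - a) = s * det2 (p - a) (b - a)"
    unfolding s(3) by (simp add: det2_def algebra_simps)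
  then have nc: "\<not> collinear {a, p, y}"
    using general[OF abL(1) pL abL(2)] pa pb abL s0 by (simp add: collinear_iff_det2)
  have ay: "closed_segment a y \<subseteq> closed_segment a b" using y by (simp add: closed_segment_subset)
  have yp: "closed_segment y p \<subseteq> closed_segment p (e p)" using y by (simp add: closed_segment_subset)
  have b_ay: "b \<notin> closed_segment a y" by (rule segment_antisym[OF y(2,4)])
  have ep: "x = y" if "x = e p" "x \<in> closed_segment y p" for x
    using that y(1) segment_antisym[of y p "e p"] by (auto simp: closed_segment_commute)
  have y_free: "y \<notin> closed_segment q (e q)" if "q \<in> K - {p}" for q
    using ab that y unfolding K'.visible_def by blast
  have "\<exists>P\<subseteq>K'.visible_edges. finite P \<and> odd_vertices P = {a, p} \<and> weight P < dist a y + dist y p \<and>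
           (\<forall>f\<in>P. f \<subseteq> convex hull {a, p, y})"
  proof (rule K'.shortcut[OF abL(1) pL nc segment_below[OF abL(1,2) y(2)]])
    fix q assume q: "q \<in> K - {p}"
    then have qL: "q \<in> L" "q \<noteq> p" using K_sub by auto
    show "closed_segment q (e q) \<inter> (closed_segment a y \<union> closed_segment y p) \<subseteq> {a, p, y}"
    proof
      fix x assume x: "x \<in> closed_segment q (e q) \<inter> (closed_segment a y \<union> closed_segment y p)"
      show "x \<in> {a, p, y}"
      proof (cases "x \<in> closed_segment a y")
        case True
        then show ?thesis using x ay ab q b_ay unfolding K'.visible_def by blast
      next
        case False
        then have xp: "x \<in> closed_segment y p" "x \<in> closed_segment p (e p)" using x yp by auto
        \<comment> \<open>Barriers meet only at an end. If \<open>x\<close> were \<open>e q\<close>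
          but not \<open>e p\<close>, then \<open>q\<close> would end before \<open>p\<close>,
          against minimality; and \<open>e p\<close> lies between \<open>y\<close> and
          \<open>p\<close> only if it is \<open>y\<close>.\<close>
        then have "x = e p \<or> x = e q" using barriers_meet[OF pL qL(1)] qL x by blast
        then have "x = e p" using barrier_inner_less[OF pL xp(2)] p(2)[of q] q by fastforce
        then show ?thesis using ep xp by blast
      qed
    qed
    show "y \<in> closed_segment q (e q) \<Longrightarrow> closed_segment q (e q) \<inter> convex hull {a, p, y} \<subseteq> {y}"
      using y_free[OF q] by blast
  next
    show "L \<inter> (closed_segment a y \<union> closed_segment y p) \<subseteq> {a, p, y}"
      using vertex_on_segment[OF abL(1,2)] vertex_on_barrier[OF pL] ay yp b_ay by blast
  qed
  then obtain P where P: "P \<subseteq> K'.visible_edges" "finite P" "odd_vertices P = {a, p}" "\<And>f. f \<in> P \<Longrightarrow> f \<subseteq> convex hull {a, p, y}"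
    by blast
  \<comment> \<open>The string was built ignoring the barrier of \<open>p\<close>. It avoids this
    one too, because it stays in the triangle \<open>a p y\<close>, on one side of the line through
    \<open>p\<close> and \<open>y\<close>.\<close>
  have "P \<subseteq> visible_edges"
  proof
    fix f assume f: "f \<in> P"
    then obtain u v where uv: "f = {u, v}" "K'.visible u v" using P unfolding K'.visible_edges_def by blast
    then have uvL: "u \<in> L" "v \<in> L" "u \<noteq> v" by (auto simp: K'.visible_def)
    define g where "g x = det2 (e p - p) (x - p)" for x
    have ga: "g a \<noteq> 0" using general_end[OF pL abL(1)] pa by (auto simp: g_def collinear_iff_det2)
    \<comment> \<open>Since \<open>g\<close> vanishes at \<open>p\<close> and \<open>y\<close>, the
      quotient is the barycentric coordinate of \<open>w\<close> at \<open>a\<close>. It is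
      nonnegative, and nonzero by general position.\<close>
    have g_pos: "g w / g a > 0" if w: "w \<in> L" "w \<in> f" "w \<noteq> p" for w
    proof -
      obtain k l where kl: "0 \<le> k" "0 \<le> l" "k + l \<le> 1" "w = a + k *\<^sub>R (p - a) + l *\<^sub>R (y - a)"
        using P(4)[OF f] w unfolding convex_hull_3_alt by blast
      have "g w = (1 - k - l) * g a + l * g y"
        unfolding g_def kl(4) by (simp add: det2_def algebra_simps)
      also have "g y = 0" using det2_barrier[OF y(1)] by (simp add: g_def)
      finally have "g w / g a = 1 - k - l" using ga by simp
      moreover have "g w \<noteq> 0" using general_end[OF pL w(1)] w by (auto simp: g_def collinear_iff_det2)
      ultimately show ?thesis using kl ga by (smt (verit) divide_eq_0_iff)
    qed
    have "closed_segment p (e p) \<inter> closed_segment u v \<subseteq> {u, v}"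
    proof
      fix x assume x: "x \<in> closed_segment p (e p) \<inter> closed_segment u v"
      then obtain t where t: "0 \<le> t" "t \<le> 1" "x = (1 - t) *\<^sub>R u + t *\<^sub>R v" by (auto simp: in_segment)
      have "g x = (1 - t) * g u + t * g v" unfolding g_def t(3) by (simp add: det2_def algebra_simps)
      moreover have "g x = 0" using x det2_barrier by (auto simp: g_def)
      ultimately have z: "(1 - t) * (g u / g a) + t * (g v / g a) = 0" using ga by (simp add: field_simps)
      have gp: "g p = 0" by (simp add: g_def det2_def)
      consider "u = p" "v \<noteq> p" | "v = p" "u \<noteq> p" | "u \<noteq> p" "v \<noteq> p" using uvL by blast
      then show "x \<in> {u, v}"
      proof cases
        case 1
        then have "t = 0" using z g_pos[of v] uvL uv gp by auto
        then show ?thesis using t by simp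
      next
        case 2
        then have "t = 1" using z g_pos[of u] uvL uv gp by auto
        then show ?thesis using t by simp
      next
        case 3
        then have "g u / g a > 0" "g v / g a > 0" using g_pos uvL uv by auto
        then have "(1 - t) * (g u / g a) + t * (g v / g a) > 0"
          using t by (cases "t = 0") (auto intro!: add_nonneg_pos mult_pos_pos mult_nonneg_nonneg simp del: times_divide_eq_right)
        then show ?thesis using z by simp
      qed
    qed
    then have "visible u v" using uv(2) p(1) unfolding K'.visible_def visible_def by blast
    then show "f \<in> visible_edges" using uv visible_edges_pair by blast
  qed
  then show ?thesis using P pa by blast
qed

text \<open>An edge cut by the new barrier is replaced by a string from \<open>a\<close> to
  \<open>p\<close> and one from \<open>b\<close> to \<open>p\<close>; modulo 2 the odd degree at
  \<open>p\<close> cancels.\<close>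

lemma repair:
  assumes p: "p \<in> K" "\<And>q. q \<in> K \<Longrightarrow> n \<bullet> e p \<le> n \<bullet> e q"
    and f: "f \<in> barriers.visible_edges L (K - {p}) e"
  shows "\<exists>P\<subseteq>visible_edges. finite P \<and> odd_vertices P = f"
proof -
  interpret K': barriers n X L "K - {p}" e by (rule remove_barrier[OF p])
  obtain a b where ab: "f = {a, b}" "K'.visible a b" using f unfolding K'.visible_edges_def by blast
  then have abL: "a \<in> L" "b \<in> L" "a \<noteq> b" by (auto simp: K'.visible_def)
  show ?thesis
  proof (cases "visible a b")
    case True
    then show ?thesis using ab visible_edges_pair by (intro exI[of _ "{f}"]) (auto simp: odd_vertices_singleton)
  next
    case False
    then obtain y where y: "y \<in> closed_segment p (e p)" "y \<in> closed_segment a b" "y \<noteq> a" "y \<noteq> b"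
      using ab(2) unfolding K'.visible_def visible_def by blast
    obtain P where P: "P \<subseteq> visible_edges" "finite P" "odd_vertices P = {a, p}" "p \<noteq> a"
      using half_repair[OF p ab(2) y] by blast
    have "K'.visible b a" using ab K'.visible_commute by blast
    moreover have "y \<in> closed_segment b a" using y by (simp add: closed_segment_commute)
    ultimately obtain Q where Q: "Q \<subseteq> visible_edges" "finite Q" "odd_vertices Q = {b, p}" "p \<noteq> b"
      using half_repair[OF p _ y(1) _ y(4,3)] by blast
    have "odd_vertices (sym_diff P Q) = f" using P Q ab abL by (subst odd_vertices_sym_diff) auto
    then show ?thesis using P Q by (intro exI[of _ "sym_diff P Q"]) auto
  qed
qed

end

text \<open>Without barriers all pairs are visible. Peeling off the barrier with the smallest end
  reduces to fewer barriers, and putting it back repairs each edge separately.\<close>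

lemma pair_join:
  assumes "barriers n X L K e" "a \<in> L" "b \<in> L" "a \<noteq> b"
  shows "\<exists>P\<subseteq>barriers.visible_edges L K e. finite P \<and> odd_vertices P = {a, b}"
  using assms
proof (induction "card K" arbitrary: K)
  case 0
  interpret barriers n X L K e by fact
  have "K = {}" using 0(1) finite_subset[OF K_sub finite_L] by simp
  then have "visible a b" unfolding visible_def using 0 by simp
  then show ?case using visible_edges_pair by (intro exI[of _ "{{a, b}}"]) (auto simp: odd_vertices_singleton)
next
  case (Suc k)
  interpret barriers n X L K e by fact
  have fin: "finite K" "K \<noteq> {}" using Suc by (auto intro: card_ge_0_finite)
  then obtain p where p: "p \<in> K" "\<And>q. q \<in> K \<Longrightarrow> - (n \<bullet> e q) \<le> - (n \<bullet> e p)"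
    using finite_has_max[of K "\<lambda>p. - (n \<bullet> e p)"] by blast
  then have p': "\<And>q. q \<in> K \<Longrightarrow> n \<bullet> e p \<le> n \<bullet> e q" by simp
  have "k = card (K - {p})" using Suc fin p by simp
  then obtain P where P: "P \<subseteq> barriers.visible_edges L (K - {p}) e" "finite P" "odd_vertices P = {a, b}"
    using Suc.hyps(1) remove_barrier[OF p(1) p'] Suc.prems by blast
  then show ?case using join_transfer[OF repair[OF p(1) p'] P(2,1)] by simp
qed

section \<open>Length-decreasing exchanges and the minimal T-join\<close>

context barriers
begin

text \<open>With \<open>a\<close> and \<open>b\<close> on the same side of the line of the barrier
  at \<open>c\<close>, that barrier meets the triangle \<open>a b c\<close> only in
  \<open>c\<close>, which is the corner condition of \<open>shortcut\<close>.\<close>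

lemma fork_shortcut:
  assumes ac: "visible a c" and bc: "visible b c" and "a \<noteq> b"
    and same_side: "det2 (e c - c) (a - c) * det2 (e c - c) (b - c) > 0"
  shows "\<exists>P\<subseteq>visible_edges. finite P \<and> odd_vertices P = {a, b} \<and> weight P < dist a c + dist c b"
proof -
  have L: "a \<in> L" "b \<in> L" "c \<in> L" "a \<noteq> c" "b \<noteq> c" using ac bc by (auto simp: visible_def)
  define g where "g x = det2 (e c - c) (x - c)" for x
  have "\<exists>P\<subseteq>visible_edges. finite P \<and> odd_vertices P = {a, b} \<and> weight P < dist a c + dist c b \<and>
           (\<forall>f\<in>P. f \<subseteq> convex hull {a, b, c})"
  proof (rule shortcut[OF L(1,2) general[OF L(1,2,3) \<open>a \<noteq> b\<close> L(4,5)] below[OF L(3)]])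
    fix p assume p: "p \<in> K"
    show "closed_segment p (e p) \<inter> (closed_segment a c \<union> closed_segment c b) \<subseteq> {a, b, c}"
      using ac bc p unfolding visible_def by (auto simp: closed_segment_commute)
    assume "c \<in> closed_segment p (e p)"
    then have "c = p" using vertex_on_barrier L p K_sub by blast
    show "closed_segment p (e p) \<inter> convex hull {a, b, c} \<subseteq> {c}"
    proof
      fix x assume x: "x \<in> closed_segment p (e p) \<inter> convex hull {a, b, c}"
      then have "x \<in> convex hull {c, a, b}" by (simp add: insert_commute)
      then obtain k l where kl: "0 \<le> k" "0 \<le> l" "x = c + k *\<^sub>R (a - c) + l *\<^sub>R (b - c)"
        unfolding convex_hull_3_alt by blast
      have "g x = k * g a + l * g b" unfolding kl(3) g_def by (simp add: det2_def algebra_simps)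
      moreover have "g x = 0" using x det2_barrier \<open>c = p\<close> by (auto simp: g_def)
      \<comment> \<open>Multiplying by \<open>g a\<close> turns the sum into one of two nonnegative
        terms, whatever the common sign of \<open>g a\<close> and \<open>g b\<close> is.\<close>
      ultimately have "0 = g a * (k * g a + l * g b)" by simp
      also have "\<dots> = k * (g a)\<^sup>2 + l * (g a * g b)" by (simp add: algebra_simps power2_eq_square)
      finally have z: "k * (g a)\<^sup>2 + l * (g a * g b) = 0" by simp
      have pos: "g a * g b > 0" "(g a)\<^sup>2 > 0" using same_side by (auto simp: g_def)
      then have "k * (g a)\<^sup>2 \<ge> 0" "l * (g a * g b) \<ge> 0" using kl by auto
      then have "k = 0" "l = 0" using z pos by (auto simp: add_nonneg_eq_0_iff)
      then show "x \<in> {c}" using kl by simp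
    qed
  next
    show "L \<inter> (closed_segment a c \<union> closed_segment c b) \<subseteq> {a, b, c}"
      using vertex_on_segment L by blast
  qed
  then show ?thesis by blast
qed

text \<open>The crossing point \<open>x\<close> serves as a corner that is not a vertex. No barrier
  passes through it, as it is inner to two visibility edges, so the corner condition is
  vacuous.\<close>

lemma crossing_shortcut:
  assumes ab: "visible a b" and cd: "visible c d" and ne: "a \<noteq> c" "a \<noteq> d" "b \<noteq> c" "b \<noteq> d"
    and x: "x \<in> closed_segment a b" "x \<in> closed_segment c d"
  shows "\<exists>P\<subseteq>visible_edges. finite P \<and> odd_vertices P = {a, c} \<and> weight P < dist a x + dist x c"
proof -
  have L: "a \<in> L" "b \<in> L" "c \<in> L" "d \<in> L" "a \<noteq> b" using ab cd by (auto simp: visible_def)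
  have "x \<notin> L" using vertex_on_segment L x ne by metis
  then have xne: "x \<noteq> a" "x \<noteq> b" "x \<noteq> c" "x \<noteq> d" using L by auto
  obtain s where s: "x = a + s *\<^sub>R (b - a)" using x(1) by (auto simp: in_segment algebra_simps)
  have "s \<noteq> 0" using s xne by auto
  moreover have "det2 (c - a) (x - a) = s * det2 (c - a) (b - a)"
    unfolding s by (simp add: det2_def algebra_simps)
  ultimately have nc: "\<not> collinear {a, c, x}"
    using general[OF L(1,3,2)] ne L(5) by (auto simp: collinear_iff_det2)
  have sub: "closed_segment a x \<subseteq> closed_segment a b" "closed_segment x c \<subseteq> closed_segment c d"
    using x by (auto simp: closed_segment_subset)
  have far: "b \<notin> closed_segment a x" "d \<notin> closed_segment x c"
    using segment_antisym[OF x(1) xne(2)] segment_antisym[OF x(2) xne(4)]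
    by (auto simp: closed_segment_commute)
  have "\<exists>P\<subseteq>visible_edges. finite P \<and> odd_vertices P = {a, c} \<and> weight P < dist a x + dist x c \<and>
           (\<forall>f\<in>P. f \<subseteq> convex hull {a, c, x})"
  proof (rule shortcut[OF L(1,3) nc segment_below[OF L(1,2) x(1)]])
    fix p assume p: "p \<in> K"
    have T: "closed_segment p (e p) \<inter> closed_segment a b \<subseteq> {a, b}"
      "closed_segment p (e p) \<inter> closed_segment c d \<subseteq> {c, d}"
      using ab cd p by (auto simp: visible_def)
    show "closed_segment p (e p) \<inter> (closed_segment a x \<union> closed_segment x c) \<subseteq> {a, c, x}"
      using T sub far by blast
    show "x \<in> closed_segment p (e p) \<Longrightarrow> closed_segment p (e p) \<inter> convex hull {a, c, x} \<subseteq> {x}"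
      using T x xne by blast
  next
    show "L \<inter> (closed_segment a x \<union> closed_segment x c) \<subseteq> {a, c, x}"
      using vertex_on_segment[OF L(1,2)] vertex_on_segment[OF L(3,4)] sub far by blast
  qed
  then show ?thesis by blast
qed

end

context barriers
begin

lemma finite_visible_edges: "finite visible_edges"
  by (rule finite_subset[of _ "Pow L"]) (auto simp: visible_edges_def visible_def finite_L)

lemma matching_exists:
  assumes "even (card L)"
  shows "\<exists>F\<subseteq>visible_edges. perfect_matching L F"
proof -
  define C where "C = {F. F \<subseteq> visible_edges \<and> odd_vertices F = L}"
  have "C \<subseteq> Pow visible_edges" by (auto simp: C_def)
  then have "finite C" using finite_visible_edges finite_subset by blast
  moreover have "C \<noteq> {}"
    using even_set_join[OF pair_join[OF barriers_axioms] finite_L assms] by (auto simp: C_def)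
  ultimately obtain F where FC: "F \<in> C" and mn: "\<And>G. G \<in> C \<Longrightarrow> - weight G \<le> - weight F"
    using finite_has_max[of C "\<lambda>F. - weight F"] by blast
  have F: "F \<subseteq> visible_edges" "odd_vertices F = L" using FC by (auto simp: C_def)
  have finF: "finite F" using F finite_visible_edges finite_subset by blast
  \<comment> \<open>Replacing \<open>D\<close> by a \<open>P\<close> of the same boundary keeps all
    parities, so minimality forbids any gain in length.\<close>
  have exchange: "weight D \<le> weight P" if "D \<subseteq> F" "P \<subseteq> visible_edges" "odd_vertices P = odd_vertices D" for D P
  proof -
    have fin: "finite D" "finite P" using that finF finite_visible_edges finite_subset by blast+
    have "F - D = sym_diff F D" using that by auto
    then have "odd_vertices (F - D) = sym_diff (odd_vertices F) (odd_vertices D)" using fin finF by (metis odd_vertices_sym_diff)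
    then have "odd_vertices (sym_diff (F - D) P) = L"
      using fin finF that F by (subst odd_vertices_sym_diff) auto
    then have "sym_diff (F - D) P \<in> C" using F that by (auto simp: C_def)
    then have "weight F \<le> weight (sym_diff (F - D) P)" using mn by fastforce
    also have "\<dots> \<le> weight (F - D) + weight P" using fin finF by (intro weight_sym_diff) auto
    also have "weight (F - D) = weight F - weight D"
      unfolding weight_def using that finF by (simp add: sum_diff)
    finally show ?thesis by simp
  qed
  have degree: "vertex_degree F c = 1" if c: "c \<in> L" for c
  proof -
    define N where "N = {a. {a, c} \<in> F}"
    have NL: "visible a c" if "a \<in> N" for a using that F(1) visible_edges_pair_iff unfolding N_def by blast
    have "{f \<in> F. c \<in> f} = (\<lambda>a. {a, c}) ` N"
    proof
      show "{f \<in> F. c \<in> f} \<subseteq> (\<lambda>a. {a, c}) ` N"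
      proof
        fix f assume f: "f \<in> {f \<in> F. c \<in> f}"
        then obtain a b where "f = {a, b}" using F unfolding visible_edges_def by blast
        then obtain a where "f = {a, c}" using f by blast
        then show "f \<in> (\<lambda>a. {a, c}) ` N" using f by (auto simp: N_def)
      qed
    qed (auto simp: N_def)
    moreover have "inj_on (\<lambda>a. {a, c}) N" by (auto simp: inj_on_def doubleton_eq_iff)
    ultimately have deg: "vertex_degree F c = card N" by (simp add: vertex_degree_def card_image)
    have "odd (card N)" using c F(2) deg by (auto simp: odd_vertices_def vertex_degree_def)
    moreover have "\<not> 3 \<le> card N"
    proof
      assume "3 \<le> card N"
      then obtain S where "S \<subseteq> N" "card S = 3" by (meson obtain_subset_with_card_n)
      then obtain x y z where xyz: "x \<in> N" "y \<in> N" "z \<in> N" "x \<noteq> y" "x \<noteq> z" "y \<noteq> z"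
        unfolding card_3_iff by blast
      define g where "g a = det2 (e c - c) (a - c)" for a
      have g0: "g a \<noteq> 0" if "a \<in> N" for a
        using NL[OF that] general_end[OF c, of a] by (auto simp: visible_def g_def collinear_iff_det2)
      txt \<open>Two of three neighbours of \<open>c\<close> lie on the same side of the barrier of \<open>c\<close>.\<close>
      have "g x * g y > 0 \<or> g x * g z > 0 \<or> g y * g z > 0"
        using g0[OF xyz(1)] g0[OF xyz(2)] g0[OF xyz(3)] by (auto simp: zero_less_mult_iff)
      then obtain a b where ab: "a \<in> N" "b \<in> N" "a \<noteq> b" "g a * g b > 0" using xyz by blast
      then obtain P where P: "P \<subseteq> visible_edges" "finite P" "odd_vertices P = {a, b}" "weight P < dist a c + dist c b"
        using fork_shortcut[OF NL NL, of a b] by (auto simp: g_def)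
      define D where "D = {{a, c}, {b, c}}"
      have ne: "{a, c} \<noteq> {b, c}" "a \<noteq> c" "b \<noteq> c"
        using ab NL[of a] NL[of b] by (auto simp: doubleton_eq_iff visible_def)
      then have "D = sym_diff {{a, c}} {{b, c}}" by (auto simp: D_def)
      then have "odd_vertices D = sym_diff (odd_vertices {{a, c}}) (odd_vertices {{b, c}})" by (metis odd_vertices_sym_diff finite.intros)
      then have "odd_vertices D = {a, b}" using ne ab by (auto simp: odd_vertices_singleton)
      moreover have "D \<subseteq> F" using ab by (auto simp: D_def N_def)
      ultimately have "weight D \<le> weight P" using exchange P by simp
      moreover have "weight D = dist a c + dist b c"
        using ne by (simp add: weight_def D_def edge_length_pair)
      ultimately show False using P by (simp add: dist_commute)
    qed
    ultimately have "card N = 1" by presburger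
    then show ?thesis using deg by simp
  qed
  have unique: "f = g" if "f \<in> F" "g \<in> F" "v \<in> f" "v \<in> g" "v \<in> L" for f g v
  proof -
    have "card {f \<in> F. v \<in> f} = 1"
      using degree[OF that(5)] by (simp add: vertex_degree_def)
    then obtain h where h: "{f \<in> F. v \<in> f} = {h}" by (rule card_1_singletonE)
    have "f \<in> {f \<in> F. v \<in> f}" "g \<in> {f \<in> F. v \<in> f}" using that by simp_all
    then show ?thesis unfolding h by simp
  qed
  have noncr: "\<not> crosses f g" if fg: "f \<in> F" "g \<in> F" for f g
  proof
    assume "crosses f g"
    then obtain x where x: "f \<noteq> g" "x \<in> convex hull f" "x \<in> convex hull g" by (auto simp: crosses_def)
    obtain a b where ab: "f = {a, b}" "visible a b" using fg F unfolding visible_edges_def by blast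
    obtain c d where cd: "g = {c, d}" "visible c d" using fg F unfolding visible_edges_def by blast
    have L: "a \<in> L" "b \<in> L" "c \<in> L" "d \<in> L" "a \<noteq> b" "c \<noteq> d" using ab cd by (auto simp: visible_def)
    \<comment> \<open>Degree one has already been shown, so distinct edges share no
      endpoint.\<close>
    have ne: "a \<noteq> c" "a \<noteq> d" "b \<noteq> c" "b \<noteq> d"
      using unique[OF fg] x(1) ab cd L by blast+
    have xs: "x \<in> closed_segment a b" "x \<in> closed_segment c d"
      using x ab cd by (auto simp: segment_convex_hull)
    obtain P where P: "P \<subseteq> visible_edges" "finite P" "odd_vertices P = {a, c}" "weight P < dist a x + dist x c"
      using crossing_shortcut[OF ab(2) cd(2) ne xs] by blast
    have "visible b a" "visible d c" "x \<in> closed_segment b a" "x \<in> closed_segment d c"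
      using ab cd xs visible_commute by (auto simp: closed_segment_commute)
    \<comment> \<open>The strings from \<open>a\<close> to \<open>c\<close> and from
      \<open>b\<close> to \<open>d\<close> together have the boundary of the two crossing edges, and
      both are compared with routes through \<open>x\<close>.\<close>
    then obtain Q where Q: "Q \<subseteq> visible_edges" "finite Q" "odd_vertices Q = {b, d}" "weight Q < dist b x + dist x d"
      using crossing_shortcut[of b a d c x] ne by blast
    define D where "D = {{a, b}, {c, d}}"
    have fg_ne: "{a, b} \<noteq> {c, d}" using ab cd x by simp
    then have "D = sym_diff {{a, b}} {{c, d}}" by (auto simp: D_def)
    then have "odd_vertices D = sym_diff (odd_vertices {{a, b}}) (odd_vertices {{c, d}})" by (metis odd_vertices_sym_diff finite.intros)
    then have "odd_vertices D = {a, b, c, d}" using ne by (auto simp: odd_vertices_singleton)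
    moreover have "odd_vertices (sym_diff P Q) = {a, b, c, d}"
      using P Q ne L by (subst odd_vertices_sym_diff) auto
    moreover have "D \<subseteq> F" using fg ab cd by (auto simp: D_def)
    moreover have "sym_diff P Q \<subseteq> visible_edges" using P Q by auto
    ultimately have "weight D \<le> weight (sym_diff P Q)" using exchange by simp
    also have "\<dots> \<le> weight P + weight Q" using P Q by (intro weight_sym_diff)
    also have "\<dots> < (dist a x + dist x b) + (dist c x + dist x d)"
      using P Q by (simp add: dist_commute)
    also have "dist a x + dist x b = dist a b"
      using xs(1) by (metis between between_mem_segment)
    also have "dist c x + dist x d = dist c d"
      using xs(2) by (metis between between_mem_segment)
    also have "dist a b + dist c d = weight D"
      using fg_ne by (simp add: weight_def D_def edge_length_pair)
    finally show False by simp
  qed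
  have "\<exists>p\<in>L. \<exists>q\<in>L. p \<noteq> q \<and> f = {p, q}" if "f \<in> F" for f
  proof -
    have "f \<in> visible_edges" using F(1) that by blast
    then show ?thesis unfolding visible_edges_def visible_def by blast
  qed
  then have "perfect_matching L F"
    unfolding perfect_matching_def geometric_graph_def non_crossing_def
    using degree finite_L noncr by simp
  then show ?thesis using F by blast
qed

end

section \<open>Extending disjoint segments to barriers\<close>

lemma extend_segments:
  fixes L :: "point set" and r :: "point \<Rightarrow> point"
  assumes fin: "finite L"
    and right: "\<And>p. p \<in> L \<Longrightarrow> n \<bullet> p < n \<bullet> r p"
    and below: "\<And>p. p \<in> L \<Longrightarrow> n \<bullet> r p < X"
    and gp: "\<And>p q. \<lbrakk>p \<in> L; q \<in> L; p \<noteq> q\<rbrakk> \<Longrightarrow> \<not> collinear {p, r p, r q}"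
    and disj: "\<And>p q. \<lbrakk>p \<in> L; q \<in> L; p \<noteq> q\<rbrakk> \<Longrightarrow> closed_segment p (r p) \<inter> closed_segment q (r q) = {}"
  obtains e where
    "\<And>p. p \<in> L \<Longrightarrow> \<exists>t\<ge>1. e p = p + t *\<^sub>R (r p - p)"
    "\<And>p q. \<lbrakk>p \<in> L; q \<in> L; p \<noteq> q\<rbrakk> \<Longrightarrow> closed_segment p (e p) \<inter> closed_segment q (e q) \<subseteq> {e p, e q}"
    "\<And>p. p \<in> L \<Longrightarrow> n \<bullet> e p = X \<or> (\<exists>q\<in>L. e p \<in> closed_segment q (e q) \<and> e p \<noteq> e q)"
proof -
  \<comment> \<open>The set \<open>S\<close> collects the segments already extended. The others keep
    their original right ends, and the stopping condition is required on \<open>S\<close>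
    only.\<close>
  have "\<exists>e. (\<forall>p\<in>L. \<exists>t\<ge>1. e p = p + t *\<^sub>R (r p - p)) \<and>
      (\<forall>p\<in>L. \<forall>q\<in>L. p \<noteq> q \<longrightarrow> closed_segment p (e p) \<inter> closed_segment q (e q) \<subseteq> {e p, e q}) \<and>
      (\<forall>p\<in>L - S. e p = r p) \<and>
      (\<forall>p\<in>S. n \<bullet> e p = X \<or> (\<exists>q\<in>L. e p \<in> closed_segment q (e q) \<and> e p \<noteq> e q))"
    if "finite S" "S \<subseteq> L" for S
    using that
  proof (induction S)
    case empty
    show ?case
    proof (intro exI[of _ r] conjI ballI impI)
      show "\<exists>t\<ge>1. r p = p + t *\<^sub>R (r p - p)" for p by (intro exI[of _ 1]) auto
    qed (use disj in auto)
  next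
    case (insert p S)
    then have "S \<subseteq> L" by simp
    from insert.IH[OF this] obtain e where ray: "\<And>p. p \<in> L \<Longrightarrow> \<exists>t\<ge>1. e p = p + t *\<^sub>R (r p - p)"
      and meet: "\<And>p q. p \<in> L \<Longrightarrow> q \<in> L \<Longrightarrow> p \<noteq> q \<Longrightarrow> closed_segment p (e p) \<inter> closed_segment q (e q) \<subseteq> {e p, e q}"
      and rest: "\<And>p. p \<in> L - S \<Longrightarrow> e p = r p"
      and ends: "\<And>p. p \<in> S \<Longrightarrow> n \<bullet> e p = X \<or> (\<exists>q\<in>L. e p \<in> closed_segment q (e q) \<and> e p \<noteq> e q)"
      by blast
    have pL: "p \<in> L" and epr: "e p = r p" using insert rest by auto
    define v where "v = r p - p"
    define c where "c t = p + t *\<^sub>R v" for t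
    have c1: "c 1 = r p" by (simp add: c_def v_def)
    have nv: "n \<bullet> v > 0" using right[OF pL] by (simp add: v_def inner_diff_right)
    then have "v \<noteq> 0" by auto
    then have c_inj: "c s = c t \<Longrightarrow> s = t" for s t by (simp add: c_def)
    have c_seg: "x \<in> closed_segment p (c T) \<longleftrightarrow> (\<exists>t. 0 \<le> t \<and> t \<le> T \<and> x = c t)" if "T \<ge> 1" for x T
    proof
      assume "x \<in> closed_segment p (c T)"
      then obtain k where "0 \<le> k" "k \<le> 1" "x = (1 - k) *\<^sub>R p + k *\<^sub>R c T" by (auto simp: in_segment)
      then show "\<exists>t. 0 \<le> t \<and> t \<le> T \<and> x = c t" using that
        by (intro exI[of _ "k * T"]) (auto simp: c_def algebra_simps mult_left_le_one_le)
    next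
      assume "\<exists>t. 0 \<le> t \<and> t \<le> T \<and> x = c t"
      then obtain t where t: "0 \<le> t" "t \<le> T" "x = c t" by blast
      then have "x = (1 - t / T) *\<^sub>R p + (t / T) *\<^sub>R c T" using that by (simp add: c_def algebra_simps)
      then show "x \<in> closed_segment p (c T)" unfolding in_segment using t that by (intro exI[of _ "t / T"]) auto
    qed
    \<comment> \<open>The parameter at which the ray from \<open>p\<close> reaches the bounding
      line.\<close>
    define tX where "tX = (X - n \<bullet> p) / (n \<bullet> v)"
    have ntX: "n \<bullet> c tX = X" using nv by (simp add: tX_def c_def inner_add_right)
    have tX: "tX \<ge> 1" using nv below[OF pL] by (simp add: tX_def v_def inner_diff_right field_simps)
    define A where "A = {1..tX} \<inter> c -` (\<Union>q\<in>L - {p}. closed_segment q (e q))"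
    have "closed (c -` (\<Union>q\<in>L - {p}. closed_segment q (e q)))"
    proof (rule closed_vimage)
      show "closed (\<Union>q\<in>L - {p}. closed_segment q (e q))" using fin by (intro closed_UN) auto
      show "continuous_on UNIV c" unfolding c_def by (intro continuous_intros)
    qed
    then have "compact A" unfolding A_def by (intro compact_Int_closed) auto
    \<comment> \<open>Compactness of \<open>A\<close> yields the first hit beyond
      \<open>r p\<close>; without a hit the ray runs on to the bounding line.\<close>
    have "\<exists>T. 1 \<le> T \<and> T \<le> tX \<and> (T = tX \<or> T \<in> A) \<and> (\<forall>t\<in>A. T \<le> t)"
    proof (cases "A = {}")
      case True
      then show ?thesis using tX by blast
    next
      case False
      then obtain T where "T \<in> A" "\<forall>t\<in>A. T \<le> t" using compact_attains_inf \<open>compact A\<close> by blast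
      then show ?thesis by (intro exI[of _ T]) (auto simp: A_def)
    qed
    then obtain T where T: "1 \<le> T" "T \<le> tX" "T = tX \<or> T \<in> A" "\<And>t. t \<in> A \<Longrightarrow> T \<le> t" by blast
    define e' where "e' = e(p := c T)"
    have e'p: "e' p = c T" and e'q: "\<And>q. q \<noteq> p \<Longrightarrow> e' q = e q" by (auto simp: e'_def)
    have meet_p: "closed_segment p (e' p) \<inter> closed_segment q (e' q) \<subseteq> {e' p, e' q}" if q: "q \<in> L" "q \<noteq> p" for q
    proof
      fix x assume x: "x \<in> closed_segment p (e' p) \<inter> closed_segment q (e' q)"
      then have xq: "x \<in> closed_segment q (e q)" using e'q q by simp
      obtain t where t: "0 \<le> t" "t \<le> T" "x = c t" using x c_seg[OF T(1)] by (auto simp: e'p)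
      show "x \<in> {e' p, e' q}"
      proof (cases "t \<ge> 1")
        case True
        then have "t \<in> A" using t T(2) xq q by (auto simp: A_def)
        then show ?thesis using T(4) t e'p by fastforce
      next
        case False
        then have "x \<in> closed_segment p (e p)" using c_seg[of 1 x] t c1 epr by auto
        then have "x = e p \<or> x = e q" using meet[OF pL q(1)] q(2) xq by blast
        moreover have "x \<noteq> e p" using c_inj[of t 1] False t c1 epr by auto
        ultimately show ?thesis using e'q q by simp
      qed
    qed
    \<comment> \<open>Ends resting on the old segment of \<open>p\<close> have parameter at most 1,
      so they could coincide with the new end only at \<open>e p\<close> itself.\<close>
    have old_end: "e q \<noteq> c T" if q: "e q \<in> closed_segment p (e p)" "e q \<noteq> e p" for q
    proof
      assume "e q = c T"
      moreover obtain t where "t \<le> 1" "e q = c t" using q(1) c_seg[of 1 "e q"] c1 epr by auto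
      ultimately have "T = 1" using c_inj T(1) by force
      then show False using \<open>e q = c T\<close> c1 epr q(2) by simp
    qed
    have ends': "n \<bullet> e' q = X \<or> (\<exists>q'\<in>L. e' q \<in> closed_segment q' (e' q') \<and> e' q \<noteq> e' q')" if q: "q \<in> insert p S" for q
    proof (cases "q = p")
      case True
      show ?thesis
      proof (cases "T = tX")
        case True
        then show ?thesis using \<open>q = p\<close> ntX e'p by simp
      next
        case False
        then obtain q1 where q1: "q1 \<in> L" "q1 \<noteq> p" "c T \<in> closed_segment q1 (e q1)"
          using T(3) by (auto simp: A_def)
        show ?thesis
        proof (cases "c T = e q1")
          case ce: True
          \<comment> \<open>The ray hits \<open>q1\<close> exactly at its end. By general position
            this is not an original right end, so \<open>q1\<close> was extended earlier, and
            whatever stops \<open>q1\<close> also stops \<open>p\<close>.\<close>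
          have "q1 \<in> S"
          proof (rule ccontr)
            assume "q1 \<notin> S"
            then have "r q1 = c T" using rest[of q1] q1 ce by simp
            then have "det2 (r p - p) (r q1 - p) = 0" by (simp add: c_def v_def det2_def)
            then show False using gp[OF pL q1(1)] q1 by (auto simp: collinear_iff_det2)
          qed
          then consider "n \<bullet> e q1 = X" | q2 where "q2 \<in> L" "e q1 \<in> closed_segment q2 (e q2)" "e q1 \<noteq> e q2"
            using ends by blast
          then show ?thesis
          proof cases
            case 2
            then have "q2 \<noteq> p" using old_end ce by metis
            then show ?thesis using 2 \<open>q = p\<close> ce e'p e'q[of q2] by (intro disjI2 bexI[of _ q2]) auto
          qed (use ce e'p \<open>q = p\<close> in simp)
        next
          case False
          then show ?thesis using q1 e'p e'q[OF q1(2)] \<open>q = p\<close> by (intro disjI2 bexI[of _ q1]) auto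
        qed
      qed
    next
      case False
      then have "q \<in> S" using q by simp
      then consider "n \<bullet> e q = X" | q2 where "q2 \<in> L" "e q \<in> closed_segment q2 (e q2)" "e q \<noteq> e q2"
        using ends by blast
      then show ?thesis
      proof cases
        case 2
        show ?thesis
        proof (cases "q2 = p")
          case True
          then have "e q \<noteq> e' p" using 2 old_end e'p by auto
          moreover obtain t where "0 \<le> t" "t \<le> 1" "e q = c t" using 2 True c_seg[of 1 "e q"] c1 epr by auto
          then have "e q \<in> closed_segment p (e' p)" using c_seg[OF T(1)] T(1) e'p by auto
          ultimately show ?thesis using pL False e'q[of q] by (intro disjI2 bexI[of _ p]) auto
        next
          case ne: False
          then show ?thesis using 2 e'q[of q] e'q[of q2] False by (intro disjI2 bexI[of _ q2]) auto
        qed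
      qed (use e'q False in simp)
    qed
    show ?case
    proof (intro exI[of _ e'] conjI ballI impI)
      show "\<exists>t\<ge>1. e' q = q + t *\<^sub>R (r q - q)" if "q \<in> L" for q
        using ray[OF that] T(1) by (cases "q = p") (auto simp: e'p e'q c_def v_def)
      show "closed_segment q (e' q) \<inter> closed_segment q' (e' q') \<subseteq> {e' q, e' q'}"
        if "q \<in> L" "q' \<in> L" "q \<noteq> q'" for q q'
      proof (cases "q = p \<or> q' = p")
        case True
        then show ?thesis using that meet_p by blast
      next
        case False
        then show ?thesis using that meet e'q by simp
      qed
      show "e' q = r q" if "q \<in> L - insert p S" for q using that rest e'q by auto
      show "n \<bullet> e' q = X \<or> (\<exists>q'\<in>L. e' q \<in> closed_segment q' (e' q') \<and> e' q \<noteq> e' q')" if "q \<in> insert p S" for q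
        using ends' that by blast
    qed
  qed
  from this[OF fin order_refl] show ?thesis using that by blast
qed

section \<open>Application to the segments of the given matching\<close>

lemma one_sided_matching:
  fixes L :: "point set" and r :: "point \<Rightarrow> point"
  assumes fin: "finite L" and even: "even (card L)"
    and right: "\<And>p. p \<in> L \<Longrightarrow> n \<bullet> p < n \<bullet> r p"
    and gp1: "\<And>a b c. \<lbrakk>a \<in> L; b \<in> L; c \<in> L; a \<noteq> b; a \<noteq> c; b \<noteq> c\<rbrakk> \<Longrightarrow> \<not> collinear {a, b, c}"
    and gp2: "\<And>p q. \<lbrakk>p \<in> L; q \<in> L; p \<noteq> q\<rbrakk> \<Longrightarrow> \<not> collinear {p, r p, q}"
    and gp3: "\<And>p q. \<lbrakk>p \<in> L; q \<in> L; p \<noteq> q\<rbrakk> \<Longrightarrow> \<not> collinear {p, r p, r q}"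
    and disj: "\<And>p q. \<lbrakk>p \<in> L; q \<in> L; p \<noteq> q\<rbrakk> \<Longrightarrow> closed_segment p (r p) \<inter> closed_segment q (r q) = {}"
  shows "\<exists>F. perfect_matching L F \<and> (\<forall>p\<in>L. \<forall>f\<in>F. \<not> crosses {p, r p} f)"
proof -
  have "bdd_above ((\<lambda>p. n \<bullet> r p) ` L)" using fin by simp
  then obtain m where m: "\<And>p. p \<in> L \<Longrightarrow> n \<bullet> r p \<le> m" by (auto simp: bdd_above_def)
  \<comment> \<open>Strictly beyond all right ends, as the extension requires.\<close>
  define X where "X = m + 1"
  have rX: "n \<bullet> r p < X" if "p \<in> L" for p using m[OF that] by (simp add: X_def)
  obtain e where e: "\<And>p. p \<in> L \<Longrightarrow> \<exists>t\<ge>1. e p = p + t *\<^sub>R (r p - p)"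
    "\<And>p q. \<lbrakk>p \<in> L; q \<in> L; p \<noteq> q\<rbrakk> \<Longrightarrow> closed_segment p (e p) \<inter> closed_segment q (e q) \<subseteq> {e p, e q}"
    "\<And>p. p \<in> L \<Longrightarrow> n \<bullet> e p = X \<or> (\<exists>q\<in>L. e p \<in> closed_segment q (e q) \<and> e p \<noteq> e q)"
    using extend_segments[OF fin right rX gp3 disj] by blast
  \<comment> \<open>With \<open>K = L\<close> all barriers obstruct.\<close>
  interpret barriers n X L L e
  proof (unfold_locales, goal_cases)
    case (4 p a)
    obtain t where t: "t \<ge> 1" "e p = p + t *\<^sub>R (r p - p)" using e(1)[OF 4(1)] by blast
    have "det2 (e p - p) (a - p) = t * det2 (r p - p) (a - p)"
      unfolding t(2) by (simp add: det2_def algebra_simps)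
    then show ?case using gp2[of p a] 4 t by (simp add: collinear_iff_det2)
  next
    case (5 p)
    then show ?case using right rX by fastforce
  next
    case (6 p)
    obtain t where t: "t \<ge> 1" "e p = p + t *\<^sub>R (r p - p)" using e(1)[OF 6] by blast
    then show ?case using right[OF 6] by (simp add: inner_add_right inner_diff_right)
  qed (use fin gp1 e in blast)+
  obtain F where F: "F \<subseteq> visible_edges" "perfect_matching L F" using matching_exists[OF even] by blast
  have "\<not> crosses {p, r p} f" if pf: "p \<in> L" "f \<in> F" for p f
  proof
    assume "crosses {p, r p} f"
    then obtain x where x: "x \<in> convex hull {p, r p}" "x \<in> convex hull f" "x \<notin> {p, r p} \<inter> f"
      by (auto simp: crosses_def)
    obtain a b where ab: "f = {a, b}" "visible a b" using pf F(1) unfolding visible_edges_def by blast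
    obtain t where t: "t \<ge> 1" "e p = p + t *\<^sub>R (r p - p)" using e(1)[OF pf(1)] by blast
    have "r p = (1 - 1 / t) *\<^sub>R p + (1 / t) *\<^sub>R e p"
      using t(1) by (subst t(2)) (simp add: algebra_simps)
    then have "r p \<in> closed_segment p (e p)" unfolding in_segment using t by (intro exI[of _ "1 / t"]) auto
    then have "closed_segment p (r p) \<subseteq> closed_segment p (e p)" by (simp add: closed_segment_subset)
    then have xT: "x \<in> closed_segment p (e p)" using x by (auto simp: segment_convex_hull)
    have "x \<in> closed_segment a b" using x ab by (simp add: segment_convex_hull)
    then have "x \<in> {a, b}" using ab(2) xT pf(1) unfolding visible_def by blast
    \<comment> \<open>The only point that an edge of \<open>F\<close> can share with the segment is
      the common endpoint \<open>p\<close>, which is not a crossing.\<close>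
    moreover from this have "x = p" using vertex_on_barrier[OF pf(1) _ xT] ab(2) by (auto simp: visible_def)
    ultimately show False using x ab by simp
  qed
  then show ?thesis using F by blast
qed

text \<open>Left and right are expressed by a direction \<open>n\<close>, so that opposite
  directions give the two halves of the result.\<close>

lemma endpoint_matching:
  assumes pm: "perfect_matching V M" and even: "even (card M)" and gp: "general_position V"
    and distinct: "\<And>p q. {p, q} \<in> M \<Longrightarrow> n \<bullet> p \<noteq> n \<bullet> q"
    and L: "L = {p. \<exists>q. {p, q} \<in> M \<and> n \<bullet> p < n \<bullet> q}"
  shows "\<exists>F. perfect_matching L F \<and> (\<forall>e\<in>M. \<forall>f\<in>F. \<not> crosses e f)"
proof -
  have finV: "finite V" and edges: "\<And>e. e \<in> M \<Longrightarrow> \<exists>p\<in>V. \<exists>q\<in>V. p \<noteq> q \<and> e = {p, q}"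
    and ncr: "\<And>e f. e \<in> M \<Longrightarrow> f \<in> M \<Longrightarrow> \<not> crosses e f"
    and deg: "\<And>v. v \<in> V \<Longrightarrow> vertex_degree M v = 1"
    using pm by (auto simp: perfect_matching_def geometric_graph_def non_crossing_def)
  have inV: "v \<in> V" if "v \<in> e" "e \<in> M" for v e using edges that by blast
  have unique: "e = f" if "e \<in> M" "f \<in> M" "v \<in> e" "v \<in> f" for e f v
  proof -
    have "card {e \<in> M. v \<in> e} = 1"
      using deg[OF inV[OF that(3,1)]] by (simp add: vertex_degree_def)
    then obtain h where h: "{e \<in> M. v \<in> e} = {h}" by (rule card_1_singletonE)
    have "e \<in> {e \<in> M. v \<in> e}" "f \<in> {e \<in> M. v \<in> e}" using that by simp_all
    then show ?thesis unfolding h by simp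
  qed
  have "\<forall>p\<in>L. \<exists>q. {p, q} \<in> M \<and> n \<bullet> p < n \<bullet> q" using L by blast
  then obtain r where r: "\<And>p. p \<in> L \<Longrightarrow> {p, r p} \<in> M" "\<And>p. p \<in> L \<Longrightarrow> n \<bullet> p < n \<bullet> r p" by metis
  have LV: "p \<in> V" "r p \<in> V" "r p \<noteq> p" if "p \<in> L" for p
    using r[OF that] inV[of _ "{p, r p}"] by auto
  have apart: "{p, r p} \<inter> {q, r q} = {}" if "p \<in> L" "q \<in> L" "p \<noteq> q" for p q
  proof (rule ccontr)
    assume "{p, r p} \<inter> {q, r q} \<noteq> {}"
    then obtain v where "v \<in> {p, r p}" "v \<in> {q, r q}" by blast
    then have "{p, r p} = {q, r q}" by (rule unique[OF r(1)[OF that(1)] r(1)[OF that(2)]])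
    then have "p = r q" "q = r p" using that by (auto simp: doubleton_eq_iff)
    then show False using r(2)[OF that(1)] r(2)[OF that(2)] by simp
  qed
  \<comment> \<open>Each edge is named by its endpoint in \<open>L\<close>. As the naming is
    injective, \<open>L\<close> inherits the even cardinality of \<open>M\<close>.\<close>
  have M_eq: "M = (\<lambda>p. {p, r p}) ` L"
  proof
    show "(\<lambda>p. {p, r p}) ` L \<subseteq> M" using r by blast
    show "M \<subseteq> (\<lambda>p. {p, r p}) ` L"
    proof
      fix e assume e: "e \<in> M"
      then obtain p q where "e = {p, q}" using edges by blast
      then have "n \<bullet> p < n \<bullet> q \<or> n \<bullet> q < n \<bullet> p" using distinct[of p q] e by auto
      moreover have "e = {q, p}" using \<open>e = {p, q}\<close> by (simp add: insert_commute)
      ultimately obtain p q where pq: "e = {p, q}" "n \<bullet> p < n \<bullet> q"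
        using \<open>e = {p, q}\<close> by blast
      then have "p \<in> L" using L e by blast
      moreover have "e = {p, r p}" using unique[OF e r(1)[OF \<open>p \<in> L\<close>], of p] pq by simp
      ultimately show "e \<in> (\<lambda>p. {p, r p}) ` L" by blast
    qed
  qed
  have "inj_on (\<lambda>p. {p, r p}) L"
  proof (rule inj_onI, rule ccontr)
    fix p q assume pq: "p \<in> L" "q \<in> L" "{p, r p} = {q, r q}" "p \<noteq> q"
    then show False using apart[OF pq(1,2,4)] by simp
  qed
  then have "card M = card L" unfolding M_eq by (rule card_image)
  then have evenL: "even (card L)" using even by simp
  have finL: "finite L" using LV finV by (meson finite_subset subsetI)
  have gp': "\<not> collinear {a, b, c}" if "a \<in> V" "b \<in> V" "c \<in> V" "a \<noteq> b" "a \<noteq> c" "b \<noteq> c" for a b c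
    using gp that unfolding general_position_def by blast
  \<comment> \<open>Without common endpoints, being non-crossing means being disjoint.\<close>
  have disj: "closed_segment p (r p) \<inter> closed_segment q (r q) = {}" if "p \<in> L" "q \<in> L" "p \<noteq> q" for p q
  proof -
    have "{p, r p} \<noteq> {q, r q}" using apart[OF that] by auto
    then have "x \<notin> convex hull {q, r q}" if "x \<in> convex hull {p, r p}" for x
      using ncr[OF r(1)[OF \<open>p \<in> L\<close>] r(1)[OF \<open>q \<in> L\<close>]] that
      unfolding crosses_def apart[OF \<open>p \<in> L\<close> \<open>q \<in> L\<close> \<open>p \<noteq> q\<close>] by simp
    then show ?thesis unfolding segment_convex_hull by blast
  qed
  have "\<exists>F. perfect_matching L F \<and> (\<forall>p\<in>L. \<forall>f\<in>F. \<not> crosses {p, r p} f)"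
  proof (rule one_sided_matching[OF finL evenL r(2) _ _ _ disj])
    show "\<not> collinear {a, b, c}" if "a \<in> L" "b \<in> L" "c \<in> L" "a \<noteq> b" "a \<noteq> c" "b \<noteq> c" for a b c
      using gp'[OF LV(1) LV(1) LV(1)] that by simp
    show "\<not> collinear {p, r p, q}" if "p \<in> L" "q \<in> L" "p \<noteq> q" for p q
      using gp'[of p "r p" q] LV[OF that(1)] LV[OF that(2)] that apart[OF that] by auto
    show "\<not> collinear {p, r p, r q}" if "p \<in> L" "q \<in> L" "p \<noteq> q" for p q
      using gp'[of p "r p" "r q"] LV[OF that(1)] LV[OF that(2)] that apart[OF that] by auto
  qed
  then show ?thesis unfolding M_eq by blast
qed

theorem theorem16:
  fixes V :: "point set" and M :: "point set set"
  assumes "perfect_matching V M"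
    and "even (card M)"
    and "general_position V"
    and "\<And>e. e \<in> M \<Longrightarrow> \<not> vertical e"
  shows "\<exists>M\<^sub>L M\<^sub>R.
           perfect_matching (left_endpoints M) M\<^sub>L \<and>
           perfect_matching (right_endpoints M) M\<^sub>R \<and>
           (\<forall>e\<in>M. \<forall>f\<in>M\<^sub>L \<union> M\<^sub>R. \<not> crosses e f)"
proof -
  have ne: "fst p \<noteq> fst q" if "{p, q} \<in> M" for p q
  proof
    assume eq: "fst p = fst q"
    have "\<forall>e\<in>M. \<exists>p\<in>V. \<exists>q\<in>V. p \<noteq> q \<and> e = {p, q}"
      using assms(1) by (simp add: perfect_matching_def geometric_graph_def)
    with that obtain p' q' where "p' \<noteq> q'" "{p, q} = {p', q'}" by meson
    then have "p \<noteq> q" by (auto simp: doubleton_eq_iff)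
    then show False using assms(4)[OF that] eq unfolding vertical_def by blast
  qed
  have 1: "(1, 0) \<bullet> p = fst p" and 2: "(- 1, 0) \<bullet> p = - fst p" for p :: point
    by (simp_all add: inner_prod_def)
  have "left_endpoints M = {p. \<exists>q. {p, q} \<in> M \<and> (1, 0) \<bullet> p < (1, 0) \<bullet> q}"
    unfolding left_endpoints_def 1 ..
  then obtain M\<^sub>L where L: "perfect_matching (left_endpoints M) M\<^sub>L" "\<And>e f. e \<in> M \<Longrightarrow> f \<in> M\<^sub>L \<Longrightarrow> \<not> crosses e f"
    using endpoint_matching[OF assms(1-3), of "(1, 0)"] ne unfolding 1 by metis
  \<comment> \<open>Right endpoints are the left endpoints with respect to the reversed
    direction.\<close>
  have "right_endpoints M = {q. \<exists>p. {q, p} \<in> M \<and> (- 1, 0) \<bullet> q < (- 1, 0) \<bullet> p}"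
    unfolding right_endpoints_def 2 neg_less_iff_less
    by (intro Collect_cong ex_cong1) (simp add: insert_commute)
  then obtain M\<^sub>R where R: "perfect_matching (right_endpoints M) M\<^sub>R" "\<And>e f. e \<in> M \<Longrightarrow> f \<in> M\<^sub>R \<Longrightarrow> \<not> crosses e f"
    using endpoint_matching[OF assms(1-3), of "(- 1, 0)"] ne unfolding 2 by (metis neg_equal_iff_equal)
  show ?thesis using L R by (intro exI[of _ M\<^sub>L] exI[of _ M\<^sub>R]) auto
qed

end
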